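(* Suppose that $0 < \inf_{x \in S} f(x) \leq \sup_{x \in S} f(x) < \infty$ and that the attractiveness function of the geometric preferential attachment (GPA) graph is $F(r) = r^{-s}$ for some $s > d$. For any $\gamma \in \left(0, \frac{s-d}{2s-d}\right)$, there exists a constant $C < \infty$ such that, for all $k \in \mathbb{N}$, $$\limsup_{n \to \infty} n^{-1} N^{\mathrm{GPA}}_n(k) \leq C \mathrm{e}^{-k^\gamma} \ \text{ almost surely}, \quad \text{and} \quad \limsup_{n \to \infty} n^{-1} \mathbb{E}[N^{\mathrm{GPA}}_n(k)] \leq C \mathrm{e}^{-k^\gamma} .$$
   Context: Here $\mathbb{N} = \{1,2,\ldots\}$ and $d \in \mathbb{N}$. $S \subset \mathbb{R}^d$ is compact, convex and of positive $d$-dimensional Lebesgue measure; $f$ is a probability density function supported on $S$; $X_0, X_1, \ldots$ are independent with density $f$; $\mathcal{X}_n = \{X_0,\ldots,X_n\}$. Write $\rho(x,y) = \|x-y\|$ for Euclidean distance. GPA graph with attractiveness function $F : (0,\infty) \to (0,\infty)$: a random sequence of graphs $G_n = (V_n,E_n)$, $n \in \mathbb{N}$, with $V_n = \{0,1,\ldots,n\}$, vertex $i$ being located at $X_i$. $G_1$ consists of vertices $0,1$ joined by the single edge $(1,0)$. Given $G_n$ and the locations, vertex $n+1$ is added at $X_{n+1}$ together with one new edge $(n+1, v_{n+1})$, where $$\mathbb{P}[v_{n+1} = v \mid G_n, \mathcal{X}_{n+1}] = \frac{\deg_n(v) F(\rho(X_v, X_{n+1}))}{D_n(X_{n+1})},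 \quad v \in V_n, \qquad D_n(x) := \sum_{v \in V_n} \deg_n(v) F(\rho(X_v,x)),$$ and $\deg_n(v)$ is the degree of $v$ in $G_n$ viewed as an undirected graph. $N^{\mathrm{GPA}}_n(k)$ is the number of vertices of $G_n$ with degree at least $k$. *)

theory Defs
  imports "HOL-Probability.Probability"
begin

text \<open>
  A graph on the vertex set \<open>{0..n}\<close> is given by its set of edges, an edge being written as
  \<open>(i, j)\<close> where \<open>i\<close> is the vertex that was added together with the edge. Degrees ignore this
  orientation; no edge is a loop and no edge occurs in both orientations in the graphs below.
\<close>

definition graph_degree :: "(nat \<times> nat) set \<Rightarrow> nat \<Rightarrow> nat" where
  "graph_degree E u = card {e \<in> E. fst e = u \<or> snd e = u}"

definition num_degree_ge :: "nat \<Rightarrow> (nat \<times> nat) set \<Rightarrow> nat \<Rightarrow> nat" where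
  "num_degree_ge n E k = card {u \<in> {0..n}. k \<le> graph_degree E u}"

definition gpa_weight ::
  "(real \<Rightarrow> real) \<Rightarrow> (nat \<times> nat) set \<Rightarrow> (nat \<Rightarrow> 'a::metric_space) \<Rightarrow> nat \<Rightarrow> 'a \<Rightarrow> real" where
  "gpa_weight F E x u y = real (graph_degree E u) * F (dist (x u) y)"

text \<open>The \<open>\<sigma>\<close>-algebra on the sample space generated by \<open>E n\<close> and \<open>X 0, \<dots>, X m\<close>.\<close>

definition gpa_sigma ::
  "'w measure \<Rightarrow> (nat \<Rightarrow> 'w \<Rightarrow> (nat \<times> nat) set) \<Rightarrow> (nat \<Rightarrow> 'w \<Rightarrow> 'a::topological_space)
    \<Rightarrow> nat \<Rightarrow> nat \<Rightarrow> 'w measure" where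
  "gpa_sigma M E X n m =
     vimage_algebra (space M) (\<lambda>\<omega>. (E n \<omega>, \<lambda>i\<in>{0..m}. X i \<omega>))
       (count_space UNIV \<Otimes>\<^sub>M (\<Pi>\<^sub>M i\<in>{0..m}. borel))"

text \<open>
  The graph \<open>G\<^sub>n\<close> is \<open>({0..n}, E n)\<close> for \<open>n \<ge> 1\<close>; the values \<open>E 0\<close>, \<open>v 0\<close> and \<open>v 1\<close> play no role.
  Assumption \<open>fresh\<close> says that the location of the new vertex is sampled independently of the
  current graph and locations. This is implicit in the sequential construction, but it follows
  neither from the independence of the locations nor from \<open>attach\<close>: without it \<open>v (Suc n)\<close>
  could be correlated with the locations of later vertices.
  The event that two locations coincide is null, so the value \<open>F 0\<close> is irrelevant.
\<close>

locale gpa_graph = prob_space M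
  for M :: "'w measure" +
  fixes S :: "(real ^ 'd::finite) set"
    and f :: "real ^ 'd \<Rightarrow> real"
    and F :: "real \<Rightarrow> real"
    and X :: "nat \<Rightarrow> 'w \<Rightarrow> real ^ 'd"
    and v :: "nat \<Rightarrow> 'w \<Rightarrow> nat"
    and E :: "nat \<Rightarrow> 'w \<Rightarrow> (nat \<times> nat) set"
  assumes compact_S: "compact S"
    and convex_S: "convex S"
    and positive_S: "0 < emeasure lborel S"
    and density_measurable: "f \<in> borel_measurable borel"
    and density_nonneg: "\<And>x. 0 \<le> f x"
    and density_integral: "(\<integral>\<^sup>+ x. ennreal (f x) \<partial>lborel) = 1"
    and density_support: "\<And>x. x \<notin> S \<Longrightarrow> f x = 0"
    and F_pos: "\<And>r. 0 < r \<Longrightarrow> 0 < F r"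
    and X_indep: "indep_vars (\<lambda>_. borel) X UNIV"
    and X_density: "\<And>i. distributed M lborel (X i) (\<lambda>x. ennreal (f x))"
    and E_1: "\<And>\<omega>. \<omega> \<in> space M \<Longrightarrow> E 1 \<omega> = {(1, 0)}"
    and E_Suc: "\<And>n \<omega>. 1 \<le> n \<Longrightarrow> \<omega> \<in> space M \<Longrightarrow>
                  E (Suc n) \<omega> = insert (Suc n, v (Suc n) \<omega>) (E n \<omega>)"
    and v_vertex: "\<And>n \<omega>. 1 \<le> n \<Longrightarrow> \<omega> \<in> space M \<Longrightarrow> v (Suc n) \<omega> \<in> {0..n}"
    and v_measurable: "\<And>n. 1 \<le> n \<Longrightarrow> v (Suc n) \<in> measurable M (count_space UNIV)"
    and fresh: "\<And>n. 1 \<le> n \<Longrightarrow>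
          indep_set (sets (gpa_sigma M E X n n)) (sets (vimage_algebra (space M) (X (Suc n)) borel))"
    and attach: "\<And>n u. 1 \<le> n \<Longrightarrow> u \<in> {0..n} \<Longrightarrow>
          (AE \<omega> in M.
             real_cond_exp M (gpa_sigma M E X n (Suc n))
               (indicator {\<omega> \<in> space M. v (Suc n) \<omega> = u}) \<omega>
             = gpa_weight F (E n \<omega>) (\<lambda>i. X i \<omega>) u (X (Suc n) \<omega>)
               / (\<Sum>w\<in>{0..n}. gpa_weight F (E n \<omega>) (\<lambda>i. X i \<omega>) w (X (Suc n) \<omega>)))"
begin

lemma E_measurable:
  assumes "1 \<le> n"
  shows "E n \<in> measurable M (count_space UNIV)"
  using assms
proof (induction n rule: dec_induct)
  case base
  have "(\<lambda>_. {(1, 0)}) \<in> measurable M (count_space UNIV)" by simp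
  then show ?case by (subst measurable_cong[OF E_1])
next
  case (step n)
  have v: "v (Suc n) \<in> measurable M (count_space UNIV)" using step by (intro v_measurable) simp
  have "(\<lambda>\<omega>. insert (Suc n, v (Suc n) \<omega>) (E n \<omega>)) \<in> measurable M (count_space UNIV)"
  proof (rule measurable_compose_countable[OF _ v])
    fix u :: nat
    show "(\<lambda>\<omega>. insert (Suc n, u) (E n \<omega>)) \<in> measurable M (count_space UNIV)"
      by (rule measurable_compose[OF step.IH]) simp
  qed
  moreover have "\<And>\<omega>. \<omega> \<in> space M \<Longrightarrow> E (Suc n) \<omega> = insert (Suc n, v (Suc n) \<omega>) (E n \<omega>)"
    using step by (intro E_Suc) simp_all
  ultimately show ?case by (subst measurable_cong)
qed

text \<open>Hence the conditional expectations in \<open>attach\<close> are genuine ones.\<close>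

lemma subalgebra_gpa_sigma:
  assumes "1 \<le> n"
  shows "subalgebra M (gpa_sigma M E X n m)"
proof -
  have X: "X i \<in> borel_measurable M" for i
    using X_density[of i] unfolding distributed_def by simp
  have XE: "(\<lambda>\<omega>. (E n \<omega>, \<lambda>i\<in>{0..m}. X i \<omega>)) \<in>
          measurable M (count_space UNIV \<Otimes>\<^sub>M (\<Pi>\<^sub>M i\<in>{0..m}. borel))"
    using E_measurable[OF assms] X by (intro measurable_Pair measurable_restrict) auto
  show ?thesis
    unfolding subalgebra_def gpa_sigma_def
    using measurable_sets[OF XE] measurable_space[OF XE]
    by (subst sets_vimage_algebra2) auto
qed

end

end

theory Submission
  imports Defs
begin

text \<open>
  Write \<open>d\<close> for the dimension and \<open>deg\<^sub>n\<close> for degrees at time \<open>n\<close>. The number of vertices of degree at least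
  \<open>k\<close> is at most \<open>exp (- (k powr \<gamma>)) * \<Phi> n\<close> for the potential
  \<open>\<Phi> n = (\<Sum>u\<le>n. exp (\<theta> * min (deg\<^sub>n u) k))\<close> with \<open>\<theta> = k powr (\<gamma> - 1)\<close>. It therefore suffices that \<open>\<Phi> n / n\<close> is
  eventually bounded by a constant which does not depend on \<open>k\<close>, provided that \<open>k\<close> is large; for the remaining
  values of \<open>k\<close> the trivial bound is enough.

  Suppose that at least \<open>a\<close> old points lie within distance \<open>r\<close> of the new location \<open>x\<close>. Then the normalizing
  sum is at least \<open>a * r powr (- s)\<close>, and a vertex of degree below \<open>k\<close> at distance \<open>\<rho>\<close> from \<open>x\<close> is chosen with
  probability at most \<open>min 1 ((k / a) * (r / \<rho>) powr s)\<close>. As \<open>s > d\<close>, the integral of this over \<open>x\<close> is of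
  order \<open>(k / a) powr (d / s) * r ^ d\<close>. With \<open>a = k powr \<gamma>\<close> and \<open>r ^ d\<close> of order \<open>a / n\<close> it is at most
  \<open>k powr ((1 - \<gamma>) * d / s + \<gamma>) / n\<close> up to a constant. Attaching an edge to a vertex multiplies its summand
  by \<open>exp \<theta>\<close>, hence the potential has mean relative growth of order
  \<open>k powr (2 * \<gamma> - 1 + (1 - \<gamma>) * d / s) / n\<close> per step, beside a bounded additive growth from the new vertices.
  The exponent of \<open>k\<close> is negative precisely for \<open>\<gamma> < (s - d) / (2 * s - d)\<close>. For large \<open>k\<close> the relative growth
  over the steps from \<open>n\<close> to \<open>2 * n\<close> is therefore by a factor close to 1, whereas \<open>n\<close> doubles, and
  \<open>\<Phi> n / n\<close> stays bounded (\<open>expected_weight_attached_le\<close>, \<open>AE_potential_doubling\<close>).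

  The new location may be sparse, with fewer than \<open>a\<close> points nearby. Then the increment of the potential is
  bounded by \<open>exp (k powr \<gamma>)\<close> only, but with the constant in \<open>r\<close> large enough the mass of sparse locations is
  at most \<open>exp (- a)\<close> up to a constant, which balances the increment. This is needed not only in the mean
  but with high probability, and follows from a variance bound for a smoothed version of that mass (\<open>variance_void_mass\<close>,
  \<open>prob_void_mass_large\<close>). The probability of failure is of order \<open>1 / n\<close> only, but this is summable
  along powers of two, and the monotonicity of the number of vertices of large degree fills the gaps.

  To pass from the drift of the potential to an almost sure bound, exponential moments are propagated through
  one doubling (\<open>exp_potential_step\<close>, \<open>prob_potential_doubling\<close>). Increments are bounded for fixed \<open>k\<close>, so
  deviations of order \<open>n\<close> have exponentially small probability, and the Borel-Cantelli lemma applies.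
\<close>

section \<open>Volumes and integrals over balls\<close>

text \<open>
  Contracting \<open>S\<close> towards its point \<open>x\<close> by the factor \<open>r / R\<close> maps \<open>S\<close> into itself by convexity, and into
  the ball of radius \<open>r\<close>.
\<close>

lemma measure_convex_inter_cball_ge:
  fixes S :: "'a::euclidean_space set"
  assumes "compact S" "convex S" "x \<in> S" "S \<subseteq> cball x R" "0 < r" "r \<le> R"
  shows "(r / R) ^ DIM('a) * measure lborel S \<le> measure lborel (S \<inter> cball x r)"
proof -
  define c where "c = r / R"
  have c: "0 < c" "c \<le> 1" using assms by (auto simp: c_def)
  define T where "T = (\<lambda>y. c *\<^sub>R y + (1 - c) *\<^sub>R x) ` S"
  have T_compact: "compact T" unfolding T_def
    by (intro compact_continuous_image continuous_intros assms)
  have sub: "T \<subseteq> S \<inter> cball x r"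
  proof
    fix z assume "z \<in> T"
    then obtain y where y: "y \<in> S" "z = c *\<^sub>R y + (1 - c) *\<^sub>R x" by (auto simp: T_def)
    have "x - z = c *\<^sub>R (x - y)" unfolding y by (simp add: algebra_simps)
    then have "dist x z = c * dist x y" using c by (simp add: dist_norm)
    also have "\<dots> \<le> c * R" using y assms c by (intro mult_left_mono) auto
    also have "\<dots> = r" using assms by (simp add: c_def)
    finally have "z \<in> cball x r" by simp
    moreover have "z \<in> S"
      unfolding y using y(1) assms(2,3) c by (intro convexD) auto
    ultimately show "z \<in> S \<inter> cball x r" by simp
  qed
  have "emeasure lebesgue T = c ^ DIM('a) * emeasure lebesgue S"
    unfolding T_def using c emeasure_lebesgue_affine[of c "(1 - c) *\<^sub>R x" S] by simp
  then have "measure lebesgue T = c ^ DIM('a) * measure lebesgue S"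
    using c by (simp add: measure_def enn2real_mult)
  then have "measure lborel T = c ^ DIM('a) * measure lborel S"
    using T_compact assms(1) by (simp add: borel_compact measure_completion)
  moreover have "measure lborel T \<le> measure lborel (S \<inter> cball x r)"
    using sub T_compact assms(1)
    by (intro measure_mono_fmeasurable fmeasurable_compact) (auto intro!: borel_compact fmeasurable_compact compact_Int)
  ultimately show ?thesis by (simp add: c_def)
qed

text \<open>
  The kernel is at most 1 up to radius \<open>R = A powr (1 / s)\<close> and at most \<open>2 powr (s - s * j)\<close> on the annulus
  between \<open>2 ^ (j - 1) * R\<close> and \<open>2 ^ j * R\<close>.
\<close>

lemma truncated_kernel_le_annuli:
  fixes x y :: "'a::metric_space"
  assumes "0 < A" "0 < s"
  shows "ennreal (min 1 (A * dist y x powr (- s)))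
    \<le> (\<Sum>j. ennreal (2 powr (s - s * real j)) * indicator (cball y (2 ^ j * A powr (1 / s))) x)"
    (is "_ \<le> (\<Sum>j. ?t j)")
proof -
  define R where "R = A powr (1 / s)"
  have R: "0 < R" "R powr s = A" using assms by (auto simp: R_def powr_powr)
  (* A single summand already dominates: the one of the annulus that contains x. *)
  obtain j where "ennreal (min 1 (A * dist y x powr (- s))) \<le> ?t j"
  proof (cases "dist y x \<le> R")
    case True
    have "1 \<le> (2::real) powr s" using assms by (intro ge_one_powr_ge_zero) auto
    then have "ennreal (min 1 (A * dist y x powr (- s))) \<le> ?t 0"
      using True by (auto simp: R_def intro!: ennreal_leI)
    then show ?thesis by (rule that)
  next
    case False
    obtain j0 where "dist y x / R < 2 ^ j0" using real_arch_pow[of 2 "dist y x / R"] by auto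
    then have ex: "dist y x \<le> 2 ^ j0 * R" using R by (simp add: field_simps)
    define j where "j = (LEAST j. dist y x \<le> 2 ^ j * R)"
    have j: "dist y x \<le> 2 ^ j * R" unfolding j_def by (rule LeastI) (rule ex)
    have j_pos: "j \<noteq> 0" using False j by (intro notI) simp
    then have "\<not> dist y x \<le> 2 ^ (j - 1) * R"
      using not_less_Least[of "j - 1" "\<lambda>j. dist y x \<le> 2 ^ j * R"] by (simp add: j_def)
    then have lt: "2 ^ (j - 1) * R < dist y x" by simp
    have "A * dist y x powr (- s) \<le> A * (2 ^ (j - 1) * R) powr (- s)"
      using assms R lt by (intro mult_left_mono powr_mono2') auto
    also have "\<dots> = (2 powr real (j - 1)) powr (- s)"
      using R assms by (simp add: powr_mult powr_realpow powr_minus field_simps)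
    also have "\<dots> = 2 powr (s - s * real j)"
      using j_pos by (simp add: powr_powr of_nat_diff algebra_simps)
    finally have "ennreal (min 1 (A * dist y x powr (- s))) \<le> ?t j"
      using j by (auto simp: R_def intro!: ennreal_leI)
    then show ?thesis by (rule that)
  qed
  also have "?t j \<le> (\<Sum>j. ?t j)"
    using sum_le_suminf[of ?t "{j}"] by (simp only: summableI finite.intros sum.insert_remove sum.empty Diff_empty empty_Diff add_0_right zero_le simp_thms)
  finally show ?thesis .
qed

text \<open>
  Summing the volumes of the balls gives a geometric series of ratio \<open>2 powr (d - s)\<close>; this is where
  \<open>s > d\<close> enters.
\<close>

lemma nn_integral_truncated_kernel_le:
  fixes s :: real
  assumes s: "real DIM('a::euclidean_space) < s"
  obtains c where "0 \<le> c"
    "\<And>A (y :: 'a). 0 < A \<Longrightarrow>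
      (\<integral>\<^sup>+ x. ennreal (min 1 (A * dist y x powr (- s))) \<partial>lborel) \<le> ennreal (c * A powr (real DIM('a) / s))"
proof -
  let ?d = "DIM('a)"
  define q :: real where "q = 2 powr (real ?d - s)"
  have q: "0 < q" "q < 1" unfolding q_def using s by (auto simp: powr_less_one)
  define V :: real where "V = unit_ball_vol (real ?d)"
  have V: "0 \<le> V" by (simp add: V_def)
  define c where "c = 2 powr s * V / (1 - q)"
  have s0: "0 < s" using s by (meson le_less_trans of_nat_0_le_iff)
  show ?thesis
  proof (rule that)
    show "0 \<le> c" using q V by (simp add: c_def)
    fix A :: real and y :: 'a assume A: "0 < A"
    define R where "R = A powr (1 / s)"
    have R: "0 < R" using A by (simp add: R_def)
    have "(\<integral>\<^sup>+ x. ennreal (min 1 (A * dist y x powr (- s))) \<partial>lborel)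
      \<le> (\<integral>\<^sup>+ x. (\<Sum>j. ennreal (2 powr (s - s * real j)) * indicator (cball y (2 ^ j * R)) x) \<partial>lborel)"
      unfolding R_def by (intro nn_integral_mono truncated_kernel_le_annuli A s0)
    also have "\<dots> = (\<Sum>j. ennreal (2 powr (s - s * real j)) * emeasure lborel (cball y (2 ^ j * R)))"
      by (subst nn_integral_suminf) (simp_all only: nn_integral_cmult_indicator sets_lborel borel_measurable_indicator borel_closed closed_cball borel_measurable_const borel_measurable_times_ennreal measurable_lborel1)
    also have "\<dots> = (\<Sum>j. ennreal (2 powr s * V * R ^ ?d * q ^ j))"
    proof (intro suminf_cong)
      fix j
      have "2 powr (s - s * real j) * (V * (2 ^ j * R) ^ ?d)
        = V * R ^ ?d * (2 powr (s - s * real j) * (2 powr (real j)) powr real ?d)"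
        by (simp add: power_mult_distrib powr_realpow)
      also have "\<dots> = V * R ^ ?d * 2 powr (s + (real ?d - s) * real j)"
        by (simp add: powr_powr powr_add[symmetric] algebra_simps)
      also have "2 powr (s + (real ?d - s) * real j) = 2 powr s * q ^ j"
        by (simp add: powr_add q_def powr_power mult_ac)
      finally have "2 powr (s - s * real j) * (V * (2 ^ j * R) ^ ?d) = 2 powr s * V * R ^ ?d * q ^ j"
        by (simp only: mult_ac)
      moreover have "emeasure lborel (cball y (2 ^ j * R)) = ennreal (V * (2 ^ j * R) ^ ?d)"
        using R unfolding V_def by (subst emeasure_cball) simp_all
      ultimately show "ennreal (2 powr (s - s * real j)) * emeasure lborel (cball y (2 ^ j * R))
        = ennreal (2 powr s * V * R ^ ?d * q ^ j)"
        by (metis ennreal_mult' powr_ge_zero)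
    qed
    also have "\<dots> = ennreal (2 powr s * V * R ^ ?d * (1 / (1 - q)))"
      using q V R by (intro suminf_ennreal_eq sums_mult geometric_sums) auto
    also have "2 powr s * V * R ^ ?d * (1 / (1 - q)) = c * A powr (real ?d / s)"
      using A by (simp add: c_def R_def powr_power)
    finally show "(\<integral>\<^sup>+ x. ennreal (min 1 (A * dist y x powr (- s))) \<partial>lborel)
      \<le> ennreal (c * A powr (real ?d / s))" .
  qed
qed

section \<open>Sparse regions of an independent sample\<close>

locale iid_points = prob_space M
  for M :: "'w measure" +
  fixes L :: "'a::euclidean_space measure"
    and X :: "nat \<Rightarrow> 'w \<Rightarrow> 'a"
  assumes points_indep: "indep_vars (\<lambda>_. borel) X UNIV"
    and points_law: "\<And>i. distr M borel (X i) = L"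
begin

lemma point_measurable [measurable]: "X i \<in> borel_measurable M"
  using points_indep unfolding indep_vars_def by simp

lemma prob_space_law: "prob_space L"
  unfolding points_law[of 0, symmetric] by (rule prob_space_distr) simp

lemma sets_law [simp, measurable_cong]: "sets L = sets borel"
  unfolding points_law[of 0, symmetric] by simp

lemma space_law [simp]: "space L = UNIV"
  unfolding points_law[of 0, symmetric] by simp

lemma integral_law:
  fixes h :: "'a \<Rightarrow> real"
  assumes "h \<in> borel_measurable borel"
  shows "(\<integral>\<omega>. h (X i \<omega>) \<partial>M) = (\<integral>x. h x \<partial>L)"
  unfolding points_law[of i, symmetric] using assms by (subst integral_distr) simp_all

lemma expectation_prod_points:
  fixes h :: "'a \<Rightarrow> real"
  assumes [measurable]: "h \<in> borel_measurable borel" and "\<And>x. 0 \<le> h x" "\<And>x. h x \<le> 1"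
  shows "(\<integral>\<omega>. (\<Prod>j<n. h (X j \<omega>)) \<partial>M) = (\<integral>x. h x \<partial>L) ^ n"
proof -
  have "(\<integral>\<omega>. (\<Prod>j<n. h (X j \<omega>)) \<partial>M) = (\<Prod>j<n. \<integral>\<omega>. h (X j \<omega>) \<partial>M)"
  proof (rule indep_vars_lebesgue_integral)
    show "indep_vars (\<lambda>_. borel) (\<lambda>i \<omega>. h (X i \<omega>)) {..<n}"
      by (rule indep_vars_compose2[where M' = "\<lambda>_. borel"])
        (auto intro: indep_vars_subset[OF points_indep])
    show "integrable M (\<lambda>\<omega>. h (X i \<omega>))" for i
      using assms by (intro integrable_const_bound[where B = 1]) auto
  qed simp
  then show ?thesis by (simp add: integral_law)
qed

definition damp :: "real \<Rightarrow> 'a \<Rightarrow> 'a \<Rightarrow> real" where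
  "damp r x y = (if dist x y \<le> r then exp (- 1) else 1)"

text \<open>
  The product of the damping factors is \<open>exp (- N)\<close>, where \<open>N\<close> is the number of sample points within
  distance \<open>r\<close> of \<open>x\<close>. Thus the void mass is a smooth substitute for the mass of the set of locations with
  few sample points nearby. Unlike an indicator, the exponential factorizes over independent points.
\<close>

definition void_mass :: "nat \<Rightarrow> real \<Rightarrow> 'w \<Rightarrow> real" where
  "void_mass n r \<omega> = (\<integral>x. (\<Prod>j<n. damp r x (X j \<omega>)) \<partial>L)"

lemma damp_measurable [measurable]:
  assumes [measurable]: "g \<in> borel_measurable N" "h \<in> borel_measurable N"
  shows "(\<lambda>z. damp r (g z) (h z)) \<in> borel_measurable N"
  unfolding damp_def by measurable

lemma damp_bounds: "0 \<le> damp r x y" "damp r x y \<le> 1"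
  by (auto simp: damp_def)

lemma prod_damp_bounds:
  fixes n :: nat
  shows "0 \<le> (\<Prod>j<n. damp r x (y j))" "(\<Prod>j<n. damp r x (y j)) \<le> 1"
  by (auto intro!: prod_nonneg prod_le_1 simp: damp_bounds)

lemma prod_damp_eq:
  fixes n :: nat
  shows "(\<Prod>j<n. damp r x (y j)) = exp (- real (card {j \<in> {..<n}. dist x (y j) \<le> r}))"
proof -
  have "(\<Prod>j<n. damp r x (y j)) = (\<Prod>j\<in>{j \<in> {..<n}. dist x (y j) \<le> r}. exp (- 1))"
    unfolding damp_def by (subst prod.inter_filter[symmetric]) auto
  then show ?thesis by (simp add: exp_of_nat_mult[symmetric])
qed

lemma void_mass_measurable_wrt:
  assumes "\<And>j. j < n \<Longrightarrow> X j \<in> borel_measurable N"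
  shows "void_mass n r \<in> borel_measurable N"
proof -
  interpret L: prob_space L by (rule prob_space_law)
  have "(\<lambda>(\<omega>, x). \<Prod>j<n. damp r x (X j \<omega>)) \<in> borel_measurable (N \<Otimes>\<^sub>M L)"
    unfolding case_prod_beta
    by (intro borel_measurable_prod damp_measurable measurable_compose[OF measurable_fst assms]) auto
  then show ?thesis unfolding void_mass_def by (rule L.borel_measurable_lebesgue_integral)
qed

lemma void_mass_measurable [measurable]: "void_mass n r \<in> borel_measurable M"
  by (rule void_mass_measurable_wrt) simp

lemma void_mass_bounds: "0 \<le> void_mass n r \<omega>" "void_mass n r \<omega> \<le> 1"
proof -
  interpret L: prob_space L by (rule prob_space_law)
  show "0 \<le> void_mass n r \<omega>"
    unfolding void_mass_def by (intro integral_nonneg_AE AE_I2 prod_damp_bounds)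
  have "void_mass n r \<omega> \<le> (\<integral>x. 1 \<partial>L)" unfolding void_mass_def
    by (intro integral_mono L.integrable_const_bound[where B = 1])
      (auto simp: prod_damp_bounds abs_of_nonneg)
  then show "void_mass n r \<omega> \<le> 1" using L.prob_space by simp
qed

lemma indicator_cball_integrable: "integrable L (indicator (cball x r) :: 'a \<Rightarrow> real)"
proof -
  interpret L: prob_space L by (rule prob_space_law)
  show ?thesis by (intro integrable_real_indicator) (auto simp: L.emeasure_eq_measure borel_closed)
qed

lemma integral_damp: "(\<integral>z. damp r x z \<partial>L) = 1 - (1 - exp (- 1)) * measure L (cball x r)"
proof -
  interpret L: prob_space L by (rule prob_space_law)
  have "(\<integral>z. damp r x z \<partial>L) = (\<integral>z. 1 - (1 - exp (- 1)) * indicator (cball x r) z \<partial>L)"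
    by (intro Bochner_Integration.integral_cong) (auto simp: damp_def indicator_def)
  also have "\<dots> = 1 - (1 - exp (- 1)) * measure L (cball x r)"
    using L.prob_space
    by (subst Bochner_Integration.integral_diff) (simp_all add: indicator_cball_integrable)
  finally show ?thesis .
qed

lemma integral_damp_damp:
  assumes "2 * r < dist x y"
  shows "(\<integral>z. damp r x z * damp r y z \<partial>L)
    = 1 - (1 - exp (- 1)) * (measure L (cball x r) + measure L (cball y r))"
proof -
  interpret L: prob_space L by (rule prob_space_law)
  have disj: "\<not> (dist x z \<le> r \<and> dist y z \<le> r)" for z
    using assms dist_triangle2[of x y z] by linarith
  have "damp r x z * damp r y z
      = 1 - (1 - exp (- 1)) * (indicator (cball x r) z + indicator (cball y r) z)" for z
    using disj[of z] by (auto simp: damp_def indicator_def)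
  then have "(\<integral>z. damp r x z * damp r y z \<partial>L)
    = (\<integral>z. 1 - (1 - exp (- 1)) * (indicator (cball x r) z + indicator (cball y r) z) \<partial>L)"
    by simp
  also have "\<dots> = 1 - (1 - exp (- 1)) * (measure L (cball x r) + measure L (cball y r))"
    using L.prob_space
    by (subst Bochner_Integration.integral_diff) (simp_all add: indicator_cball_integrable)
  finally show ?thesis .
qed

lemma integral_damp_bounds: "0 \<le> (\<integral>z. damp r x z \<partial>L)" "(\<integral>z. damp r x z \<partial>L) \<le> 1"
proof -
  interpret L: prob_space L by (rule prob_space_law)
  show "0 \<le> (\<integral>z. damp r x z \<partial>L)" by (intro integral_nonneg_AE AE_I2 damp_bounds)
  show "(\<integral>z. damp r x z \<partial>L) \<le> 1" by (simp add: integral_damp)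
qed

lemma expectation_void_mass:
  "expectation (void_mass n r) = (\<integral>x. (\<integral>z. damp r x z \<partial>L) ^ n \<partial>L)"
proof -
  interpret L: prob_space L by (rule prob_space_law)
  interpret P: pair_prob_space M L ..
  have "expectation (void_mass n r) = (\<integral>x. (\<integral>\<omega>. (\<Prod>j<n. damp r x (X j \<omega>)) \<partial>M) \<partial>L)"
    unfolding void_mass_def
    by (subst P.Fubini_integral)
      (auto intro!: P.integrable_const_bound[where B = 1] simp: prod_damp_bounds abs_of_nonneg)
  then show ?thesis by (simp add: expectation_prod_points damp_bounds)
qed

text \<open>
  The square is an integral over pairs of locations. If the balls around the two locations are disjoint,
  a sample point can be in at most one of them, and
  \<open>1 - \<kappa> * (p + p') \<le> (1 - \<kappa> * p) * (1 - \<kappa> * p')\<close> shows that the damping factors are negatively correlated. Only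
  pairs at distance at most \<open>2 * r\<close> contribute to the variance, and they are rare.
\<close>

lemma expectation_void_mass_square:
  "expectation (\<lambda>\<omega>. (void_mass n r \<omega>)\<^sup>2)
    \<le> (expectation (void_mass n r))\<^sup>2 + (\<integral>x. measure L (cball x (2 * r)) \<partial>L)"
proof -
  interpret L: prob_space L by (rule prob_space_law)
  interpret LL: pair_prob_space L L ..
  interpret P: pair_prob_space M "L \<Otimes>\<^sub>M L" ..
  define q where "q x = (\<integral>z. damp r x z \<partial>L) ^ n" for x
  have q: "0 \<le> q x" "q x \<le> 1" for x
    unfolding q_def using integral_damp_bounds by (auto intro: power_le_one)
  have q_meas [measurable]: "q \<in> borel_measurable borel"
    unfolding q_def by measurable
  have near_int: "integrable (L \<Otimes>\<^sub>M L) (\<lambda>z. indicator {z. dist (fst z) (snd z) \<le> 2 * r} z :: real)"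
    by (intro LL.integrable_const_bound[where B = 1]) (auto split: split_indicator)
  have q_int: "integrable (L \<Otimes>\<^sub>M L) (\<lambda>z. q (fst z) * q (snd z))"
    using q by (intro LL.integrable_const_bound[where B = 1]) (auto simp: mult_le_one)
  have dd_bounds: "0 \<le> (\<Prod>j<n. damp r a (y j) * damp r b (y j))"
    "(\<Prod>j<n. damp r a (y j) * damp r b (y j)) \<le> 1" for a b y
    by (auto intro!: prod_nonneg prod_le_1 mult_le_one simp: damp_bounds)
  have sq: "(void_mass n r \<omega>)\<^sup>2
      = (\<integral>z. (\<Prod>j<n. damp r (fst z) (X j \<omega>) * damp r (snd z) (X j \<omega>)) \<partial>(L \<Otimes>\<^sub>M L))" for \<omega>
  proof -
    have "integrable (L \<Otimes>\<^sub>M L) (\<lambda>z. \<Prod>j<n. damp r (fst z) (X j \<omega>) * damp r (snd z) (X j \<omega>))"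
      by (intro LL.integrable_const_bound[where B = 1]) (simp_all add: dd_bounds abs_of_nonneg)
    from LL.integral_fst'[symmetric, OF this] show ?thesis
      by (simp add: void_mass_def power2_eq_square prod.distrib)
  qed
  have pointwise: "(\<integral>x. damp r (fst z) x * damp r (snd z) x \<partial>L) ^ n
      \<le> q (fst z) * q (snd z) + indicator {z. dist (fst z) (snd z) \<le> 2 * r} z" for z
  proof (cases "dist (fst z) (snd z) \<le> 2 * r")
    case True
    have "(\<integral>x. damp r (fst z) x * damp r (snd z) x \<partial>L) \<le> (\<integral>x. 1 \<partial>L)"
      by (intro integral_mono L.integrable_const_bound[where B = 1])
        (auto simp: damp_bounds mult_le_one abs_of_nonneg)
    then have "(\<integral>x. damp r (fst z) x * damp r (snd z) x \<partial>L) ^ n \<le> 1"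
      using L.prob_space by (intro power_le_one integral_nonneg_AE AE_I2) (auto simp: damp_bounds)
    then show ?thesis using True q[of "fst z"] q[of "snd z"] by (simp add: add_increasing)
  next
    case False
    let ?\<kappa> = "1 - exp (- 1) :: real"
    let ?p = "measure L (cball (fst z) r)" and ?p' = "measure L (cball (snd z) r)"
    have "0 \<le> (?\<kappa> * ?p) * (?\<kappa> * ?p')"
      by (intro mult_nonneg_nonneg measure_nonneg) simp_all
    moreover have "(1 - a) * (1 - b) = 1 - (a + b) + a * b" for a b :: real
      by (simp add: algebra_simps)
    ultimately have "1 - ?\<kappa> * (?p + ?p') \<le> (1 - ?\<kappa> * ?p) * (1 - ?\<kappa> * ?p')"
      by (simp only: distrib_left)
    moreover have "0 \<le> 1 - ?\<kappa> * (?p + ?p')"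
      using False by (subst integral_damp_damp[symmetric])
        (auto intro!: integral_nonneg_AE AE_I2 simp: damp_bounds)
    ultimately have "(1 - ?\<kappa> * (?p + ?p')) ^ n \<le> ((1 - ?\<kappa> * ?p) * (1 - ?\<kappa> * ?p')) ^ n"
      by (intro power_mono)
    then show ?thesis
      using False by (simp add: integral_damp_damp q_def integral_damp power_mult_distrib)
  qed
  have "expectation (\<lambda>\<omega>. (void_mass n r \<omega>)\<^sup>2)
      = (\<integral>z. (\<integral>\<omega>. (\<Prod>j<n. damp r (fst z) (X j \<omega>) * damp r (snd z) (X j \<omega>)) \<partial>M) \<partial>(L \<Otimes>\<^sub>M L))"
    unfolding sq
    by (subst P.Fubini_integral)
      (auto intro!: P.integrable_const_bound[where B = 1] AE_I2
        simp: dd_bounds abs_of_nonneg case_prod_beta)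
  also have "\<dots> = (\<integral>z. (\<integral>x. damp r (fst z) x * damp r (snd z) x \<partial>L) ^ n \<partial>(L \<Otimes>\<^sub>M L))"
    by (intro Bochner_Integration.integral_cong refl expectation_prod_points)
      (auto simp: damp_bounds mult_le_one)
  also have "\<dots> \<le> (\<integral>z. q (fst z) * q (snd z) + indicator {z. dist (fst z) (snd z) \<le> 2 * r} z \<partial>(L \<Otimes>\<^sub>M L))"
    using pointwise q_int near_int
    by (intro integral_mono' Bochner_Integration.integrable_add) (auto simp: q)
  also have "\<dots> = (\<integral>z. q (fst z) * q (snd z) \<partial>(L \<Otimes>\<^sub>M L))
      + (\<integral>z. indicator {z. dist (fst z) (snd z) \<le> 2 * r} z \<partial>(L \<Otimes>\<^sub>M L))"
    using q_int near_int by (rule Bochner_Integration.integral_add)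
  also have "(\<integral>z. q (fst z) * q (snd z) \<partial>(L \<Otimes>\<^sub>M L)) = (\<integral>x. q x \<partial>L)\<^sup>2"
    by (subst LL.integral_fst'[symmetric, OF q_int]) (simp add: power2_eq_square)
  also have "(\<integral>z. (indicator {z. dist (fst z) (snd z) \<le> 2 * r} z :: real) \<partial>(L \<Otimes>\<^sub>M L))
      = (\<integral>x. (\<integral>y. indicator (cball x (2 * r)) y \<partial>L) \<partial>L)"
  proof -
    have near: "indicator {z. dist (fst z) (snd z) \<le> 2 * r} (x, y) = (indicator (cball x (2 * r)) y :: real)" for x y
      by (auto simp: indicator_def)
    show ?thesis by (subst LL.integral_fst'[symmetric, OF near_int]) (simp only: near)
  qed
  finally show ?thesis by (simp add: expectation_void_mass q_def)
qed

lemma variance_void_mass: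
  "variance (void_mass n r) \<le> (\<integral>x. measure L (cball x (2 * r)) \<partial>L)"
proof -
  have "integrable M (void_mass n r)" "integrable M (\<lambda>\<omega>. (void_mass n r \<omega>)\<^sup>2)"
    using void_mass_bounds
    by (auto intro!: integrable_const_bound[where B = 1] AE_I2 power_le_one)
  then show ?thesis
    using expectation_void_mass_square[of n r] by (subst variance_eq) auto
qed

end

section \<open>Degrees and the law of the next edge\<close>

context gpa_graph
begin

lemma finite_edges:
  assumes "1 \<le> n" "\<omega> \<in> space M"
  shows "finite (E n \<omega>)"
  using assms(1)
proof (induction n rule: dec_induct)
  case base
  then show ?case using E_1[OF assms(2)] by simp
next
  case (step n)
  then show ?case using E_Suc[OF _ assms(2), of n] by simp
qed

lemma edges_range:
  assumes "1 \<le> n" "\<omega> \<in> space M" "e \<in> E n \<omega>"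
  shows "fst e \<le> n" "snd e < fst e"
proof -
  have "\<forall>e \<in> E n \<omega>. fst e \<le> n \<and> snd e < fst e"
    using assms(1)
  proof (induction n rule: dec_induct)
    case base
    then show ?case using E_1[OF assms(2)] by simp
  next
    case (step n)
    then show ?case
      using E_Suc[OF _ assms(2), of n] v_vertex[OF _ assms(2), of n] by (auto simp: le_SucI)
  qed
  then show "fst e \<le> n" "snd e < fst e" using assms(3) by auto
qed

lemma graph_degree_new:
  assumes "1 \<le> n" "\<omega> \<in> space M"
  shows "graph_degree (E n \<omega>) (Suc n) = 0"
proof -
  have "{e \<in> E n \<omega>. fst e = Suc n \<or> snd e = Suc n} = {}"
    using edges_range[OF assms] by fastforce
  then show ?thesis by (simp only: graph_degree_def card.empty)
qed

lemma graph_degree_Suc: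
  assumes "1 \<le> n" "\<omega> \<in> space M"
  shows "graph_degree (E (Suc n) \<omega>) u
    = graph_degree (E n \<omega>) u + (if u = Suc n \<or> u = v (Suc n) \<omega> then 1 else 0)"
proof -
  have new: "(Suc n, v (Suc n) \<omega>) \<notin> E n \<omega>" using edges_range[OF assms] by fastforce
  have "{e \<in> E (Suc n) \<omega>. fst e = u \<or> snd e = u}
    = (if u = Suc n \<or> u = v (Suc n) \<omega> then insert (Suc n, v (Suc n) \<omega>) else id)
        {e \<in> E n \<omega>. fst e = u \<or> snd e = u}"
    unfolding E_Suc[OF assms] by auto
  then show ?thesis
    using new finite_edges[OF assms] by (auto simp: graph_degree_def)
qed

lemma graph_degree_pos:
  assumes "1 \<le> n" "\<omega> \<in> space M" "u \<le> n"
  shows "1 \<le> graph_degree (E n \<omega>) u"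
  using assms(1,3)
proof (induction n rule: dec_induct)
  case base
  then have "u = 0 \<or> u = 1" by auto
  then have "{e \<in> {(1::nat, 0::nat)}. fst e = u \<or> snd e = u} = {(1, 0)}" by auto
  then show ?case using E_1[OF assms(2)] by (simp add: graph_degree_def)
next
  case (step n)
  then show ?case by (cases "u = Suc n") (auto simp: graph_degree_Suc assms(2))
qed

lemma edges_restrict:
  assumes "1 \<le> n" "n \<le> m" "\<omega> \<in> space M"
  shows "E n \<omega> = {e \<in> E m \<omega>. fst e \<le> n}"
  using assms(2)
proof (induction m rule: dec_induct)
  case base
  show ?case using edges_range[OF assms(1,3)] by auto
next
  case (step m)
  then show ?case using E_Suc[OF _ assms(3), of m] assms(1) by auto
qed

lemma num_degree_ge_mono:
  assumes "1 \<le> n" "n \<le> m" "\<omega> \<in> space M"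
  shows "num_degree_ge n (E n \<omega>) k \<le> num_degree_ge m (E m \<omega>) k"
proof -
  have "graph_degree (E n \<omega>) u \<le> graph_degree (E m \<omega>) u" for u
    unfolding graph_degree_def using finite_edges[of m \<omega>] assms
    by (intro card_mono) (auto simp: edges_restrict[OF assms])
  then show ?thesis
    unfolding num_degree_ge_def using assms(2) by (intro card_mono) (auto intro: order_trans)
qed

lemma gpa_sigma_edges [measurable]: "1 \<le> n \<Longrightarrow> E n \<in> measurable (gpa_sigma M E X n m) (count_space UNIV)"
proof -
  have "(\<lambda>\<omega>. (E n \<omega>, \<lambda>i\<in>{0..m}. X i \<omega>)) \<in>
      measurable (gpa_sigma M E X n m) (count_space UNIV \<Otimes>\<^sub>M (\<Pi>\<^sub>M i\<in>{0..m}. borel))"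
    unfolding gpa_sigma_def by (rule measurable_vimage_algebra1) (auto simp: space_pair_measure space_PiM)
  from measurable_compose[OF this measurable_fst] show ?thesis by simp
qed

lemma gpa_sigma_points:
  assumes "i \<le> m"
  shows "X i \<in> borel_measurable (gpa_sigma M E X n m)"
proof -
  have "(\<lambda>\<omega>. (E n \<omega>, \<lambda>i\<in>{0..m}. X i \<omega>)) \<in>
      measurable (gpa_sigma M E X n m) (count_space UNIV \<Otimes>\<^sub>M (\<Pi>\<^sub>M i\<in>{0..m}. borel))"
    unfolding gpa_sigma_def by (rule measurable_vimage_algebra1) (auto simp: space_pair_measure space_PiM)
  from measurable_compose[OF measurable_compose[OF this measurable_snd]
      measurable_component_singleton[of i]]
  show ?thesis using assms by simp
qed

lemma space_gpa_sigma [simp]: "space (gpa_sigma M E X n m) = space M"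
  by (simp add: gpa_sigma_def)

text \<open>
  Earlier graphs can be read off later ones, so they belong to the later \<open>\<sigma>\<close>-algebras.
\<close>

lemma edges_measurable_later:
  assumes "1 \<le> n" "n \<le> m"
  shows "E n \<in> measurable (gpa_sigma M E X m m) (count_space UNIV)"
proof -
  have "(\<lambda>\<omega>. {e \<in> E m \<omega>. fst e \<le> n}) \<in> measurable (gpa_sigma M E X m m) (count_space UNIV)"
    using assms by (intro measurable_compose[OF gpa_sigma_edges]) auto
  then show ?thesis
    using assms by (subst measurable_cong[OF edges_restrict[OF assms]]) simp_all
qed

lemma gpa_sigma_Suc_points:
  assumes "1 \<le> n" "W \<in> borel_measurable (gpa_sigma M E X n n)"
  shows "W \<in> borel_measurable (gpa_sigma M E X n (Suc n))"
proof (rule measurable_mono[THEN subsetD, OF _ _ _ _ assms(2)])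
  have "(\<lambda>\<omega>. (E n \<omega>, \<lambda>i\<in>{0..n}. X i \<omega>)) \<in>
      measurable (gpa_sigma M E X n (Suc n)) (count_space UNIV \<Otimes>\<^sub>M (\<Pi>\<^sub>M i\<in>{0..n}. borel))"
    using assms(1) by (intro measurable_Pair measurable_restrict gpa_sigma_edges gpa_sigma_points) auto
  from measurable_sets[OF this] show "sets (gpa_sigma M E X n n) \<subseteq> sets (gpa_sigma M E X n (Suc n))"
    unfolding gpa_sigma_def[of M E X n n]
    by (subst sets_vimage_algebra2) (auto simp: space_pair_measure space_PiM)
qed simp_all

declare E_measurable [measurable]

definition location_law :: "(real ^ 'd) measure" where
  "location_law = density lborel (\<lambda>x. ennreal (f x))"

lemma location_law_eq: "distr M borel (X i) = location_law"
proof -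
  have "distr M borel (X i) = distr M lborel (X i)" by (rule distr_cong) simp_all
  then show ?thesis using X_density[of i] by (simp add: distributed_def location_law_def)
qed

sublocale iid_points M location_law X
  using X_indep location_law_eq by unfold_locales

text \<open>
  Independence of the past \<open>\<sigma>\<close>-algebra and the new location says that the joint law of the pair
  \<open>(\<omega>, X (Suc n) \<omega>)\<close> is a product measure, if the first component is regarded as an element of the
  sample space with the coarser \<open>\<sigma>\<close>-algebra. Keeping \<open>\<omega>\<close> itself as the first component avoids working
  on the space of finite graphs with its uncountable discrete \<open>\<sigma>\<close>-algebra.
\<close>

lemma expectation_fresh_point:
  assumes n: "1 \<le> n"
    and H [measurable]: "case_prod H \<in> borel_measurable (gpa_sigma M E X n n \<Otimes>\<^sub>M borel)"
    and bound: "\<And>\<omega> x. \<omega> \<in> space M \<Longrightarrow> \<bar>H \<omega> x\<bar> \<le> (B :: real)"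
  shows "(\<integral>\<omega>. H \<omega> (X (Suc n) \<omega>) \<partial>M) = (\<integral>\<omega>. (\<integral>x. H \<omega> x \<partial>location_law) \<partial>M)"
proof -
  let ?F = "gpa_sigma M E X n n"
  have sub: "subalgebra M ?F" by (rule subalgebra_gpa_sigma[OF n])
  have id: "(\<lambda>\<omega>. \<omega>) \<in> measurable M ?F" using sub by (auto simp: measurable_def subalgebra_def)
  interpret F: prob_space "distr M ?F (\<lambda>\<omega>. \<omega>)" by (rule prob_space_distr[OF id])
  interpret L: prob_space location_law by (rule prob_space_law)
  interpret P: pair_prob_space "distr M ?F (\<lambda>\<omega>. \<omega>)" location_law ..
  have pair: "(\<lambda>\<omega>. (\<omega>, X (Suc n) \<omega>)) \<in> measurable M (?F \<Otimes>\<^sub>M borel)"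
    using id by (intro measurable_Pair) simp_all
  have joint: "distr M ?F (\<lambda>\<omega>. \<omega>) \<Otimes>\<^sub>M location_law = distr M (?F \<Otimes>\<^sub>M borel) (\<lambda>\<omega>. (\<omega>, X (Suc n) \<omega>))"
  proof (rule pair_measure_eqI)
    fix A B assume AB: "A \<in> sets (distr M ?F (\<lambda>\<omega>. \<omega>))" "B \<in> sets location_law"
    have A: "A \<in> sets ?F" "A \<subseteq> space M" and B: "B \<in> sets borel"
      using AB sets.sets_into_space[of A ?F] by simp_all
    have A': "A \<in> sets M" using A(1) sub by (auto simp: subalgebra_def)
    have "X (Suc n) -` B \<inter> space M \<in> sets (vimage_algebra (space M) (X (Suc n)) borel)"
      using B by (rule in_vimage_algebra)
    then have "prob (A \<inter> (X (Suc n) -` B \<inter> space M)) = prob A * prob (X (Suc n) -` B \<inter> space M)"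
      using indep_setD[OF fresh[OF n] A(1)] by simp
    moreover have "(\<lambda>\<omega>. (\<omega>, X (Suc n) \<omega>)) -` (A \<times> B) \<inter> space M = A \<inter> (X (Suc n) -` B \<inter> space M)"
      by auto
    moreover have "A \<times> B \<in> sets (?F \<Otimes>\<^sub>M borel)" using A B by auto
    moreover have "(\<lambda>\<omega>. \<omega>) -` A \<inter> space M = A" using A by auto
    ultimately show "emeasure (distr M ?F (\<lambda>\<omega>. \<omega>)) A * emeasure location_law B
        = emeasure (distr M (?F \<Otimes>\<^sub>M borel) (\<lambda>\<omega>. (\<omega>, X (Suc n) \<omega>))) (A \<times> B)"
      unfolding location_law_eq[of "Suc n", symmetric] using A B id pair
      by (simp add: emeasure_distr emeasure_eq_measure ennreal_mult)
  qed (unfold_locales, auto intro!: sets_pair_measure_cong)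
  have H': "case_prod H \<in> borel_measurable (distr M ?F (\<lambda>\<omega>. \<omega>) \<Otimes>\<^sub>M location_law)"
    unfolding measurable_cong_sets[OF sets_pair_measure_cong[OF sets_distr sets_law] refl] by (rule H)
  have int: "integrable (distr M ?F (\<lambda>\<omega>. \<omega>) \<Otimes>\<^sub>M location_law) (case_prod H)"
    using H' bound by (intro P.integrable_const_bound[where B = B] AE_I2) (auto simp: space_pair_measure)
  have "(\<integral>\<omega>. H \<omega> (X (Suc n) \<omega>) \<partial>M)
      = (\<integral>z. case_prod H z \<partial>distr M (?F \<Otimes>\<^sub>M borel) (\<lambda>\<omega>. (\<omega>, X (Suc n) \<omega>)))"
    using id by (subst integral_distr) (auto intro!: measurable_Pair)
  also have "\<dots> = (\<integral>\<omega>. (\<integral>x. H \<omega> x \<partial>location_law) \<partial>distr M ?F (\<lambda>\<omega>. \<omega>))"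
    unfolding joint[symmetric] using P.integral_fst'[OF int] by simp
  also have "\<dots> = (\<integral>\<omega>. (\<integral>x. H \<omega> x \<partial>location_law) \<partial>M)"
  proof (rule integral_distr[OF id])
    show "(\<lambda>\<omega>. \<integral>x. H \<omega> x \<partial>location_law) \<in> borel_measurable ?F"
      by (rule L.borel_measurable_lebesgue_integral)
        (unfold measurable_cong_sets[OF sets_pair_measure_cong[OF refl sets_law] refl], rule H)
  qed
  finally show ?thesis .
qed

definition attach_prob :: "nat \<Rightarrow> 'w \<Rightarrow> nat \<Rightarrow> real ^ 'd \<Rightarrow> real" where
  "attach_prob n \<omega> u x = gpa_weight F (E n \<omega>) (\<lambda>i. X i \<omega>) u x
     / (\<Sum>w\<in>{0..n}. gpa_weight F (E n \<omega>) (\<lambda>i. X i \<omega>) w x)"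

lemma sum_attach_prob_le: "(\<Sum>u\<in>{0..n}. attach_prob n \<omega> u x) \<le> 1"
  unfolding attach_prob_def sum_divide_distrib[symmetric] by (simp add: divide_le_eq_1)

lemma attach_prob_bounds:
  assumes "u \<le> n" and F_nonneg: "\<And>r. 0 \<le> F r"
  shows "0 \<le> attach_prob n \<omega> u x" "attach_prob n \<omega> u x \<le> 1"
proof -
  have nn: "0 \<le> attach_prob n \<omega> w x" for w
    by (simp add: attach_prob_def gpa_weight_def F_nonneg sum_nonneg)
  then show "0 \<le> attach_prob n \<omega> u x" .
  have "attach_prob n \<omega> u x \<le> (\<Sum>u\<in>{0..n}. attach_prob n \<omega> u x)"
    using assms(1) by (intro member_le_sum) (auto simp: nn)
  then show "attach_prob n \<omega> u x \<le> 1" using sum_attach_prob_le[of n \<omega> x] by simp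
qed

text \<open>
  Conditioning on everything up to the new location replaces the indicator of \<open>v (Suc n) = u\<close> by the
  attachment probability; the new location is then integrated out. Multiplying by the past-measurable
  \<open>W\<close> expresses the conditional expectation given the past without naming it.
\<close>

lemma expectation_degree_attached:
  fixes h :: "nat \<Rightarrow> real"
  assumes n: "1 \<le> n"
    and F_meas [measurable]: "F \<in> borel_measurable borel" and F_nonneg: "\<And>r. 0 \<le> F r"
    and W [measurable]: "W \<in> borel_measurable (gpa_sigma M E X n n)"
    and W_bound: "\<And>\<omega>. \<omega> \<in> space M \<Longrightarrow> \<bar>W \<omega>\<bar> \<le> B"
    and h: "\<And>j. 0 \<le> h j" "\<And>j. h j \<le> H"
  shows "(\<integral>\<omega>. W \<omega> * h (graph_degree (E n \<omega>) (v (Suc n) \<omega>)) \<partial>M)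
    = (\<integral>\<omega>. W \<omega> * (\<integral>x. (\<Sum>u\<in>{0..n}. h (graph_degree (E n \<omega>) u) * attach_prob n \<omega> u x) \<partial>location_law) \<partial>M)"
proof -
  let ?F1 = "gpa_sigma M E X n (Suc n)" and ?F = "gpa_sigma M E X n n"
  let ?deg = "\<lambda>\<omega> u. graph_degree (E n \<omega>) u"
  have sub: "subalgebra M ?F1" by (rule subalgebra_gpa_sigma[OF n])
  interpret A: finite_measure_subalgebra M ?F1
    by unfold_locales (rule sub)
  have B: "0 \<le> B" using W_bound not_empty by force
  have H: "0 \<le> H" using h[of 0] by linarith
  have W1 [measurable]: "W \<in> borel_measurable ?F1" by (rule gpa_sigma_Suc_points[OF n W])
  have WM [measurable]: "W \<in> borel_measurable M" by (rule measurable_from_subalg[OF sub W1])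
  have v_meas [measurable]: "v (Suc n) \<in> measurable M (count_space UNIV)" by (rule v_measurable[OF n])
  note gpa_sigma_edges[OF n, measurable] E_measurable[OF n, measurable]
  have deg1 [measurable]: "(\<lambda>\<omega>. h (?deg \<omega> u)) \<in> borel_measurable ?F1" for u
    by (rule measurable_compose[OF gpa_sigma_edges[OF n]]) simp
  have degM [measurable]: "(\<lambda>\<omega>. h (?deg \<omega> u)) \<in> borel_measurable M" for u
    by (rule measurable_from_subalg[OF sub deg1])
  have deg [measurable]: "(\<lambda>\<omega>. h (?deg \<omega> u)) \<in> borel_measurable ?F" for u
    by (rule measurable_compose[OF gpa_sigma_edges[OF n]]) simp
  have rdeg [measurable]: "(\<lambda>\<omega>. real (?deg \<omega> u)) \<in> borel_measurable ?F" for u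
    by (rule measurable_compose[OF gpa_sigma_edges[OF n]]) simp
  have WH: "\<bar>W \<omega> * h j\<bar> \<le> B * H" if "\<omega> \<in> space M" for \<omega> j
    unfolding abs_mult using W_bound[OF that] h[of j] B by (intro mult_mono) auto
  have ap: "0 \<le> attach_prob n \<omega> u x" "attach_prob n \<omega> u x \<le> 1" if "u \<in> {0..n}" for \<omega> u x
    using that attach_prob_bounds[OF _ F_nonneg] by auto
  have ap_meas [measurable]: "(\<lambda>(\<omega>, x). attach_prob n \<omega> u x) \<in> borel_measurable (?F \<Otimes>\<^sub>M borel)"
    if "u \<in> {0..n}" for u
  proof -
    have [measurable]: "(\<lambda>z. gpa_weight F (E n (fst z)) (\<lambda>i. X i (fst z)) w (snd z))
        \<in> borel_measurable (?F \<Otimes>\<^sub>M borel)" if "w \<in> {0..n}" for w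
    proof -
      have [measurable]: "X w \<in> borel_measurable ?F" using that by (intro gpa_sigma_points) simp
      show ?thesis unfolding gpa_weight_def by measurable
    qed
    show ?thesis unfolding attach_prob_def case_prod_beta using that by measurable
  qed
  have ap_new: "(\<lambda>\<omega>. attach_prob n \<omega> u (X (Suc n) \<omega>)) \<in> borel_measurable M" if "u \<in> {0..n}" for u
  proof -
    have "(\<lambda>\<omega>. \<omega>) \<in> measurable M ?F"
      using subalgebra_gpa_sigma[OF n, of n] by (auto simp: measurable_def subalgebra_def)
    then have "(\<lambda>\<omega>. (\<omega>, X (Suc n) \<omega>)) \<in> measurable M (?F \<Otimes>\<^sub>M borel)"
      by (intro measurable_Pair) simp_all
    from measurable_compose[OF this ap_meas[OF that]] show ?thesis by simp
  qed
  have term_bound: "\<bar>W \<omega> * h (?deg \<omega> u) * attach_prob n \<omega> u x\<bar> \<le> B * H"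
    if "u \<in> {0..n}" "\<omega> \<in> space M" for \<omega> u x
  proof -
    have "\<bar>W \<omega> * h (?deg \<omega> u)\<bar> * \<bar>attach_prob n \<omega> u x\<bar> \<le> B * H * 1"
      using WH[OF that(2)] ap[OF that(1)] B H by (intro mult_mono) auto
    then show ?thesis by (simp only: abs_mult mult_1_right)
  qed
  have int_u: "integrable M (\<lambda>\<omega>. W \<omega> * h (?deg \<omega> u) * indicator {\<omega> \<in> space M. v (Suc n) \<omega> = u} \<omega>)" for u
    using WH B H by (intro integrable_const_bound[where B = "B * H"] AE_I2)
      (auto simp: indicator_def)
  have "(\<integral>\<omega>. W \<omega> * h (?deg \<omega> (v (Suc n) \<omega>)) \<partial>M)
    = (\<integral>\<omega>. (\<Sum>u\<in>{0..n}. W \<omega> * h (?deg \<omega> u) * indicator {\<omega> \<in> space M. v (Suc n) \<omega> = u} \<omega>) \<partial>M)"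
  proof (rule Bochner_Integration.integral_cong[OF refl])
    fix \<omega> assume "\<omega> \<in> space M"
    then show "W \<omega> * h (?deg \<omega> (v (Suc n) \<omega>))
      = (\<Sum>u\<in>{0..n}. W \<omega> * h (?deg \<omega> u) * indicator {\<omega> \<in> space M. v (Suc n) \<omega> = u} \<omega>)"
      using v_vertex[OF n, of \<omega>] by (simp add: indicator_def if_distrib sum.delta' cong: if_cong)
  qed
  also have "\<dots> = (\<Sum>u\<in>{0..n}. \<integral>\<omega>. W \<omega> * h (?deg \<omega> u) * indicator {\<omega> \<in> space M. v (Suc n) \<omega> = u} \<omega> \<partial>M)"
    by (rule Bochner_Integration.integral_sum) (rule int_u)
  also have "\<dots> = (\<Sum>u\<in>{0..n}. \<integral>\<omega>. W \<omega> * h (?deg \<omega> u) * attach_prob n \<omega> u (X (Suc n) \<omega>) \<partial>M)"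
  proof (rule sum.cong[OF refl])
    fix u assume u: "u \<in> {0..n}"
    note ap_new[OF u, measurable]
    have "(\<integral>\<omega>. W \<omega> * h (?deg \<omega> u) * indicator {\<omega> \<in> space M. v (Suc n) \<omega> = u} \<omega> \<partial>M)
      = (\<integral>\<omega>. W \<omega> * h (?deg \<omega> u) * real_cond_exp M ?F1 (indicator {\<omega> \<in> space M. v (Suc n) \<omega> = u}) \<omega> \<partial>M)"
      by (rule A.real_cond_exp_intg(2)[symmetric]) (auto intro: int_u)
    also have "\<dots> = (\<integral>\<omega>. W \<omega> * h (?deg \<omega> u) * attach_prob n \<omega> u (X (Suc n) \<omega>) \<partial>M)"
    proof (rule integral_cong_AE)
      show "AE \<omega> in M. W \<omega> * h (?deg \<omega> u) * real_cond_exp M ?F1 (indicator {\<omega> \<in> space M. v (Suc n) \<omega> = u}) \<omega>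
          = W \<omega> * h (?deg \<omega> u) * attach_prob n \<omega> u (X (Suc n) \<omega>)"
        using attach[OF n u] by eventually_elim (simp add: attach_prob_def)
    qed measurable
    finally show "(\<integral>\<omega>. W \<omega> * h (?deg \<omega> u) * indicator {\<omega> \<in> space M. v (Suc n) \<omega> = u} \<omega> \<partial>M)
      = (\<integral>\<omega>. W \<omega> * h (?deg \<omega> u) * attach_prob n \<omega> u (X (Suc n) \<omega>) \<partial>M)" .
  qed
  also have "\<dots> = (\<integral>\<omega>. (\<Sum>u\<in>{0..n}. W \<omega> * h (?deg \<omega> u) * attach_prob n \<omega> u (X (Suc n) \<omega>)) \<partial>M)"
  proof (rule Bochner_Integration.integral_sum[symmetric])
    fix u assume u: "u \<in> {0..n}"
    note ap_new[OF u, measurable]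
    show "integrable M (\<lambda>\<omega>. W \<omega> * h (?deg \<omega> u) * attach_prob n \<omega> u (X (Suc n) \<omega>))"
      using term_bound[OF u] by (intro integrable_const_bound[where B = "B * H"] AE_I2) auto
  qed
  also have "\<dots> = (\<integral>\<omega>. (\<integral>x. (\<Sum>u\<in>{0..n}. W \<omega> * h (?deg \<omega> u) * attach_prob n \<omega> u x) \<partial>location_law) \<partial>M)"
  proof (rule expectation_fresh_point[OF n, where B = "\<Sum>u\<in>{0..n}. B * H"])
    show "(\<lambda>(\<omega>, x). \<Sum>u\<in>{0..n}. W \<omega> * h (?deg \<omega> u) * attach_prob n \<omega> u x)
        \<in> borel_measurable (?F \<Otimes>\<^sub>M borel)"
      using ap_meas unfolding case_prod_beta by (intro borel_measurable_sum borel_measurable_times) measurable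
    show "\<bar>\<Sum>u\<in>{0..n}. W \<omega> * h (?deg \<omega> u) * attach_prob n \<omega> u x\<bar> \<le> (\<Sum>u\<in>{0..n}. B * H)"
      if "\<omega> \<in> space M" for \<omega> x
      using term_bound[OF _ that] by (intro order_trans[OF sum_abs] sum_mono)
  qed
  also have "\<dots> = (\<integral>\<omega>. W \<omega> * (\<integral>x. (\<Sum>u\<in>{0..n}. h (?deg \<omega> u) * attach_prob n \<omega> u x) \<partial>location_law) \<partial>M)"
    by (simp only: mult.assoc sum_distrib_left[symmetric] integral_mult_right_zero)
  finally show ?thesis .
qed

end

section \<open>Attachment with a power law\<close>

locale power_law_gpa = gpa_graph M S f "\<lambda>r. r powr (- s)" X v E
  for M :: "'w measure"
    and S :: "(real ^ 'd::finite) set"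
    and f :: "real ^ 'd \<Rightarrow> real"
    and X :: "nat \<Rightarrow> 'w \<Rightarrow> real ^ 'd"
    and v :: "nat \<Rightarrow> 'w \<Rightarrow> nat"
    and E :: "nat \<Rightarrow> 'w \<Rightarrow> (nat \<times> nat) set"
    and s :: real +
  fixes l b :: real
  assumes l_pos: "0 < l"
    and density_ge: "\<And>x. x \<in> S \<Longrightarrow> l \<le> f x"
    and density_le: "\<And>x. f x \<le> b"
    and s_gt_dim: "real CARD('d) < s"
begin

lemma s_pos: "0 < s"
  using s_gt_dim by (meson le_less_trans of_nat_0_le_iff)

lemma b_nonneg: "0 \<le> b"
  using density_nonneg density_le order_trans by blast

declare density_measurable [measurable]

lemma S_borel [measurable]: "S \<in> sets borel"
  by (rule borel_compact[OF compact_S])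

lemma AE_location_in_S: "AE x in location_law. x \<in> S"
  unfolding location_law_def
  using density_support by (subst AE_density) (auto intro!: AE_I2, fastforce)

lemma AE_location_not_in_finite:
  assumes "finite A"
  shows "AE x in location_law. x \<notin> A"
proof -
  have "AE x in lborel. x \<notin> A" using finite_imp_null_set_lborel[OF assms] by (rule AE_not_in)
  then show ?thesis
    unfolding location_law_def by (subst AE_density) auto
qed

text \<open>
  Convexity excludes cusps: every point of \<open>S\<close> sees a positive fraction of each small ball around it.
\<close>

lemma measure_location_cball_ge:
  obtains c R where "0 < c" "0 < R"
    "\<And>x r. x \<in> S \<Longrightarrow> 0 < r \<Longrightarrow> r \<le> R \<Longrightarrow> c * r ^ CARD('d) \<le> measure location_law (cball x r)"
proof -
  interpret L: prob_space location_law by (rule prob_space_law)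
  obtain R where R: "\<And>x y. x \<in> S \<Longrightarrow> y \<in> S \<Longrightarrow> dist x y \<le> R"
    using compact_imp_bounded[OF compact_S] by (auto simp: bounded_two_points)
  define R' where "R' = max R 1"
  have R': "0 < R'" by (simp add: R'_def)
  have finS: "emeasure lborel S < \<infinity>" using fmeasurableD2[OF fmeasurable_compact[OF compact_S]] by (simp add: less_top)
  have volS: "0 < measure lborel S"
    using positive_S finS by (simp add: measure_def enn2real_positive_iff)
  define c where "c = l * measure lborel S / R' ^ CARD('d)"
  show ?thesis
  proof (rule that)
    show "0 < c" using l_pos volS R' by (simp add: c_def)
    show "0 < R'" by (rule R')
    fix x r assume x: "x \<in> S" and r: "0 < r" "r \<le> R'"
    have sub: "S \<subseteq> cball x R'" using R[OF x] by (auto simp: R'_def max.coboundedI1)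
    have Sx: "S \<inter> cball x r \<in> sets borel" by (simp add: borel_closed sets.Int)
    have finSx: "emeasure lborel (S \<inter> cball x r) \<noteq> \<infinity>"
      using fmeasurableD2[OF fmeasurable_compact[of "S \<inter> cball x r"]] compact_S
      by (simp add: compact_Int)
    have "ennreal (l * measure lborel (S \<inter> cball x r)) = (\<integral>\<^sup>+ y. ennreal l * indicator (S \<inter> cball x r) y \<partial>lborel)"
      using Sx finSx l_pos by (simp add: nn_integral_cmult_indicator emeasure_eq_ennreal_measure ennreal_mult)
    also have "\<dots> \<le> (\<integral>\<^sup>+ y. ennreal (f y) * indicator (cball x r) y \<partial>lborel)"
      using density_ge by (intro nn_integral_mono) (auto simp: indicator_def intro: ennreal_leI)
    also have "\<dots> = emeasure location_law (cball x r)"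
      unfolding location_law_def
      by (subst emeasure_density) (auto simp: borel_closed)
    finally have "l * measure lborel (S \<inter> cball x r) \<le> measure location_law (cball x r)"
      by (simp add: L.emeasure_eq_measure)
    moreover have "l * ((r / R') ^ CARD('d) * measure lborel S) \<le> l * measure lborel (S \<inter> cball x r)"
      using measure_convex_inter_cball_ge[OF compact_S convex_S x sub r] l_pos by simp
    ultimately show "c * r ^ CARD('d) \<le> measure location_law (cball x r)"
      by (simp add: c_def power_divide mult_ac)
  qed
qed

lemma nn_integral_location_le:
  assumes [measurable]: "g \<in> borel_measurable borel"
  shows "(\<integral>\<^sup>+ x. g x \<partial>location_law) \<le> ennreal b * (\<integral>\<^sup>+ x. g x \<partial>lborel)"
proof -
  have "(\<integral>\<^sup>+ x. g x \<partial>location_law) = (\<integral>\<^sup>+ x. ennreal (f x) * g x \<partial>lborel)"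
    unfolding location_law_def by (rule nn_integral_density) simp_all
  also have "\<dots> \<le> (\<integral>\<^sup>+ x. ennreal b * g x \<partial>lborel)"
    by (intro nn_integral_mono mult_right_mono ennreal_leI density_le) simp
  also have "\<dots> = ennreal b * (\<integral>\<^sup>+ x. g x \<partial>lborel)" by (rule nn_integral_cmult) simp
  finally show ?thesis .
qed

lemma measure_location_cball_le:
  assumes "0 \<le> r"
  shows "measure location_law (cball x r) \<le> b * unit_ball_vol (real CARD('d)) * r ^ CARD('d)"
proof -
  interpret L: prob_space location_law by (rule prob_space_law)
  have "emeasure location_law (cball x r) = (\<integral>\<^sup>+ y. indicator (cball x r) y \<partial>location_law)"
    by (simp add: borel_closed)
  also have "\<dots> \<le> ennreal b * (\<integral>\<^sup>+ y. indicator (cball x r) y \<partial>lborel)"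
    by (intro nn_integral_location_le borel_measurable_indicator) (simp add: borel_closed)
  also have "\<dots> = ennreal (b * (unit_ball_vol (real CARD('d)) * r ^ CARD('d)))"
    using assms b_nonneg by (simp add: borel_closed emeasure_cball ennreal_mult)
  finally show ?thesis
    using assms b_nonneg by (simp add: L.emeasure_eq_measure mult_ac)
qed

lemma integral_truncated_kernel_le:
  obtains c where "0 \<le> c"
    "\<And>A y. 0 < A \<Longrightarrow>
      (\<integral>x. min 1 (A * dist y x powr (- s)) \<partial>location_law) \<le> c * A powr (real CARD('d) / s)"
proof -
  interpret L: prob_space location_law by (rule prob_space_law)
  have "real DIM(real ^ 'd) < s" using s_gt_dim by simp
  from nn_integral_truncated_kernel_le[OF this] obtain c where c: "0 \<le> c"
    "\<And>A (y :: real ^ 'd). 0 < A \<Longrightarrow>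
      (\<integral>\<^sup>+ x. ennreal (min 1 (A * dist y x powr (- s))) \<partial>lborel) \<le> ennreal (c * A powr (real DIM(real ^ 'd) / s))"
    by blast
  show ?thesis
  proof (rule that)
    show "0 \<le> b * c" using c b_nonneg by simp
    fix A :: real and y :: "real ^ 'd" assume A: "0 < A"
    have "ennreal (\<integral>x. min 1 (A * dist y x powr (- s)) \<partial>location_law)
        = (\<integral>\<^sup>+ x. ennreal (min 1 (A * dist y x powr (- s))) \<partial>location_law)"
      using A by (intro nn_integral_eq_integral[symmetric] L.integrable_const_bound[where B = 1]) auto
    also have "\<dots> \<le> ennreal b * (\<integral>\<^sup>+ x. ennreal (min 1 (A * dist y x powr (- s))) \<partial>lborel)"
      by (rule nn_integral_location_le) measurable
    also have "\<dots> \<le> ennreal b * ennreal (c * A powr (real CARD('d) / s))"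
      using c(2)[OF A, of y] by (intro mult_left_mono) simp_all
    also have "\<dots> = ennreal (b * c * A powr (real CARD('d) / s))"
      using b_nonneg c by (simp add: ennreal_mult[symmetric] mult_ac)
    finally show "(\<integral>x. min 1 (A * dist y x powr (- s)) \<partial>location_law) \<le> b * c * A powr (real CARD('d) / s)"
      using b_nonneg c by (subst (asm) ennreal_le_iff) simp_all
  qed
qed

text \<open>
  A location in \<open>S\<close> has no damping points nearby with probability exponentially small in \<open>n * r ^ d\<close>; more
  precisely, its mean damping is \<open>(1 - \<kappa> * p) ^ n \<le> exp (- \<kappa> * p * n)\<close> with \<open>\<kappa> = 1 - exp (- 1) \<ge> 1 / 2\<close> and
  \<open>p\<close> the mass of the ball. Chebyshev's inequality with the variance bound gives the concentration.
\<close>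

lemma prob_void_mass_large:
  obtains c C R where "0 < c" "0 \<le> C" "0 < R"
    "\<And>n r. 0 < r \<Longrightarrow> r \<le> R \<Longrightarrow>
      prob {\<omega> \<in> space M. 2 * exp (- (c * (real n * r ^ CARD('d)))) \<le> void_mass n r \<omega>}
        \<le> C * r ^ CARD('d) / (exp (- (c * (real n * r ^ CARD('d)))))\<^sup>2"
proof -
  interpret L: prob_space location_law by (rule prob_space_law)
  obtain c R where c: "0 < c" "0 < R"
    "\<And>x r. x \<in> S \<Longrightarrow> 0 < r \<Longrightarrow> r \<le> R \<Longrightarrow> c * r ^ CARD('d) \<le> measure location_law (cball x r)"
    using measure_location_cball_ge by blast
  define C where "C = b * unit_ball_vol (real CARD('d)) * 2 ^ CARD('d)"
  have half: "(1 / 2 :: real) \<le> 1 - exp (- 1)"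
    using exp_ge_add_one_self[of 1] by (simp add: exp_minus field_simps)
  show ?thesis
  proof (rule that)
    show "0 < c / 2" "0 < R" using c by simp_all
    show "0 \<le> C" using b_nonneg by (simp add: C_def)
    fix n :: nat and r :: real assume r: "0 < r" "r \<le> R"
    define q where "q = exp (- (c / 2 * (real n * r ^ CARD('d))))"
    have q_pos: "0 < q" by (simp add: q_def)
    have vm_int: "integrable M (void_mass n r)" "integrable M (\<lambda>\<omega>. (void_mass n r \<omega>)\<^sup>2)"
      using void_mass_bounds
      by (auto intro!: integrable_const_bound[where B = 1] AE_I2 power_le_one)
    have "expectation (void_mass n r) = (\<integral>x. (\<integral>z. damp r x z \<partial>location_law) ^ n \<partial>location_law)"
      by (rule expectation_void_mass)
    also have "\<dots> \<le> (\<integral>x. q \<partial>location_law)"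
    proof (rule integral_mono_AE)
      show "integrable location_law (\<lambda>x. (\<integral>z. damp r x z \<partial>location_law) ^ n)"
        using integral_damp_bounds
        by (intro L.integrable_const_bound[where B = 1] AE_I2) (auto intro!: power_le_one)
      show "AE x in location_law. (\<integral>z. damp r x z \<partial>location_law) ^ n \<le> q"
        using AE_location_in_S
      proof eventually_elim
        fix x assume x: "x \<in> S"
        let ?p = "measure location_law (cball x r)"
        have "c / 2 * r ^ CARD('d) \<le> 1 / 2 * ?p" using c(3)[OF x r] by simp
        also have "\<dots> \<le> (1 - exp (- 1)) * ?p" using half by (intro mult_right_mono) simp_all
        finally have "1 - (1 - exp (- 1)) * ?p \<le> 1 + - (c / 2 * r ^ CARD('d))" by simp
        also have "\<dots> \<le> exp (- (c / 2 * r ^ CARD('d)))" by (rule exp_ge_add_one_self)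
        finally have "(\<integral>z. damp r x z \<partial>location_law) ^ n \<le> exp (- (c / 2 * r ^ CARD('d))) ^ n"
          using integral_damp_bounds(1)[of r x] by (intro power_mono) (simp_all add: integral_damp)
        also have "\<dots> = q" by (simp add: q_def exp_of_nat_mult[symmetric] mult_ac)
        finally show "(\<integral>z. damp r x z \<partial>location_law) ^ n \<le> q" .
      qed
    qed simp
    also have "\<dots> = q" using L.prob_space by simp
    finally have mean: "expectation (void_mass n r) \<le> q" .
    have "variance (void_mass n r) \<le> (\<integral>x. measure location_law (cball x (2 * r)) \<partial>location_law)"
      by (rule variance_void_mass)
    also have "\<dots> \<le> (\<integral>x. C * r ^ CARD('d) \<partial>location_law)"
      using r b_nonneg measure_location_cball_le[of "2 * r"]
      by (intro integral_mono') (auto simp: C_def power_mult_distrib mult_ac)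
    also have "\<dots> = C * r ^ CARD('d)" using L.prob_space by simp
    finally have var: "variance (void_mass n r) \<le> C * r ^ CARD('d)" .
    have "prob {\<omega> \<in> space M. 2 * q \<le> void_mass n r \<omega>}
        \<le> prob {\<omega> \<in> space M. q \<le> \<bar>void_mass n r \<omega> - expectation (void_mass n r)\<bar>}"
      using mean by (intro finite_measure_mono) auto
    also have "\<dots> \<le> variance (void_mass n r) / q\<^sup>2"
      using q_pos vm_int by (intro Chebyshev_inequality) auto
    also have "\<dots> \<le> C * r ^ CARD('d) / q\<^sup>2"
      using var by (intro divide_right_mono) auto
    finally show "prob {\<omega> \<in> space M. 2 * exp (- (c / 2 * (real n * r ^ CARD('d)))) \<le> void_mass n r \<omega>}
        \<le> C * r ^ CARD('d) / (exp (- (c / 2 * (real n * r ^ CARD('d)))))\<^sup>2"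
      by (simp add: q_def)
  qed
qed

lemmas power_attach_prob_bounds = attach_prob_bounds[OF _ powr_ge_zero]

text \<open>
  Each of the \<open>a\<close> points within distance \<open>r\<close> contributes at least \<open>r powr (- s)\<close> to the normalizing sum,
  since all degrees are positive. Using \<open>a\<close> points rather than only the nearest one is what gives the
  range of \<open>\<gamma>\<close>. The new location has to avoid the old ones because the kernel takes the value
  \<open>0 powr (- s) = 0\<close> at distance 0.
\<close>

lemma attach_prob_le_kernel:
  assumes "1 \<le> m" "n \<le> Suc m" "\<omega> \<in> space M" "u \<le> m" "0 < r" "0 < a"
    and crowded: "a \<le> real (card {j \<in> {..<n}. dist x (X j \<omega>) \<le> r})"
    and x: "x \<notin> (\<lambda>j. X j \<omega>) ` {0..m}"
    and deg: "graph_degree (E m \<omega>) u \<le> k"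
  shows "attach_prob m \<omega> u x \<le> min 1 (real k * r powr s / a * dist (X u \<omega>) x powr (- s))"
proof -
  let ?w = "\<lambda>w. gpa_weight (\<lambda>r. r powr (- s)) (E m \<omega>) (\<lambda>i. X i \<omega>) w x"
  let ?N = "{j \<in> {..<n}. dist x (X j \<omega>) \<le> r}"
  have nn: "0 \<le> ?w w" for w by (simp add: gpa_weight_def)
  have "a * r powr (- s) \<le> (\<Sum>j\<in>?N. r powr (- s))"
    using crowded by (simp add: mult_right_mono)
  also have "\<dots> \<le> (\<Sum>j\<in>?N. ?w j)"
  proof (rule sum_mono)
    fix j assume j: "j \<in> ?N"
    then have jm: "j \<le> m" using assms(2) by auto
    have "0 < dist (X j \<omega>) x" using x jm by force
    then have "r powr (- s) \<le> dist (X j \<omega>) x powr (- s)"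
      using j s_pos by (intro powr_mono2') (auto simp: dist_commute)
    also have "\<dots> \<le> ?w j"
      using graph_degree_pos[OF assms(1,3) jm] mult_right_mono[of 1 "real (graph_degree (E m \<omega>) j)" "dist (X j \<omega>) x powr (- s)"]
      by (simp add: gpa_weight_def)
    finally show "r powr (- s) \<le> ?w j" .
  qed
  also have "\<dots> \<le> (\<Sum>j\<in>{0..m}. ?w j)"
    using assms(2) by (intro sum_mono2) (auto simp: nn)
  finally have D: "a * r powr (- s) \<le> (\<Sum>j\<in>{0..m}. ?w j)" .
  have pos: "0 < a * r powr (- s)" using assms by simp
  have "attach_prob m \<omega> u x \<le> ?w u / (a * r powr (- s))"
    unfolding attach_prob_def using D pos nn by (intro divide_left_mono) (auto intro: mult_pos_pos)
  also have "\<dots> \<le> real k * dist (X u \<omega>) x powr (- s) / (a * r powr (- s))"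
    using deg pos by (auto simp: gpa_weight_def intro!: divide_right_mono mult_right_mono)
  also have "\<dots> = real k * r powr s / a * dist (X u \<omega>) x powr (- s)"
    using assms by (simp add: powr_minus field_simps)
  finally show ?thesis using power_attach_prob_bounds[OF assms(4)] by simp
qed

text \<open>
  At a sparse location, with fewer than \<open>a\<close> points within distance \<open>r\<close>, the left side is bounded by \<open>H\<close>,
  and the product of damping factors, being at least \<open>exp (- a)\<close>, compensates. At all other locations the
  kernel bound applies to each vertex separately. Vertices of degree at least \<open>k\<close> have weight 0.
\<close>

lemma weighted_attach_prob_le:
  assumes "1 \<le> m" "n \<le> Suc m" "\<omega> \<in> space M" "0 < r" "0 < a"
    and x: "x \<notin> (\<lambda>j. X j \<omega>) ` {0..m}"
    and h: "\<And>j. 0 \<le> h j" "\<And>j. h j \<le> H" "\<And>j. k \<le> j \<Longrightarrow> h j = 0"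
  shows "(\<Sum>u\<in>{0..m}. h (graph_degree (E m \<omega>) u) * attach_prob m \<omega> u x)
    \<le> H * exp a * (\<Prod>j<n. damp r x (X j \<omega>))
      + (\<Sum>u\<in>{0..m}. h (graph_degree (E m \<omega>) u) * min 1 (real k * r powr s / a * dist (X u \<omega>) x powr (- s)))"
    (is "?lhs \<le> ?sparse + ?near")
proof -
  have H: "0 \<le> H" using h(1,2)[of 0] by simp
  have sparse_nonneg: "0 \<le> ?sparse" using H by (simp add: prod_damp_bounds)
  have near_nonneg: "0 \<le> ?near" using h assms by (intro sum_nonneg mult_nonneg_nonneg) auto
  show ?thesis
  proof (cases "a \<le> real (card {j \<in> {..<n}. dist x (X j \<omega>) \<le> r})")
    case True
    have "?lhs \<le> ?near"
    proof (rule sum_mono)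
      fix u assume u: "u \<in> {0..m}"
      show "h (graph_degree (E m \<omega>) u) * attach_prob m \<omega> u x
        \<le> h (graph_degree (E m \<omega>) u) * min 1 (real k * r powr s / a * dist (X u \<omega>) x powr (- s))"
      proof (cases "graph_degree (E m \<omega>) u \<le> k")
        case deg: True
        then show ?thesis
          using attach_prob_le_kernel[OF assms(1-3) _ assms(4,5) True x deg] u h(1)
          by (intro mult_left_mono) auto
      qed (simp add: h(3))
    qed
    then show ?thesis using sparse_nonneg by simp
  next
    case False
    have "?lhs \<le> (\<Sum>u\<in>{0..m}. H * attach_prob m \<omega> u x)"
      using h power_attach_prob_bounds by (intro sum_mono mult_right_mono) auto
    also have "\<dots> \<le> H * 1"
      unfolding sum_distrib_left[symmetric] using sum_attach_prob_le H by (intro mult_left_mono)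
    also have "\<dots> \<le> H * (exp a * (\<Prod>j<n. damp r x (X j \<omega>)))"
      using False H by (intro mult_left_mono) (simp_all add: prod_damp_eq exp_add[symmetric])
    finally show ?thesis using near_nonneg by (simp add: mult.assoc)
  qed
qed

text \<open>
  The integral of the truncated kernel with \<open>A = k * r powr s / a\<close> is of order \<open>A powr (d / s)\<close>, that is
  \<open>(k / a) powr (d / s) * r ^ d\<close>. For fixed \<open>k\<close> and \<open>r ^ d\<close> of order \<open>1 / n\<close>, a single vertex is therefore
  chosen with probability of order \<open>1 / n\<close>, apart from the choices made at sparse locations.
\<close>

lemma expected_weight_attached_le:
  assumes kernel: "\<And>A y. 0 < A \<Longrightarrow>
      (\<integral>x. min 1 (A * dist y x powr (- s)) \<partial>location_law) \<le> c * A powr (real CARD('d) / s)"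
    and "1 \<le> m" "n \<le> Suc m" "\<omega> \<in> space M" "0 < r" "0 < a" "1 \<le> k"
    and h: "\<And>j. 0 \<le> h j" "\<And>j. h j \<le> H" "\<And>j. k \<le> j \<Longrightarrow> h j = 0"
  shows "(\<integral>x. (\<Sum>u\<in>{0..m}. h (graph_degree (E m \<omega>) u) * attach_prob m \<omega> u x) \<partial>location_law)
    \<le> H * exp a * void_mass n r \<omega>
      + (\<Sum>u\<in>{0..m}. h (graph_degree (E m \<omega>) u)) * (c * (real k / a) powr (real CARD('d) / s) * r ^ CARD('d))"
proof -
  interpret L: prob_space location_law by (rule prob_space_law)
  let ?A = "real k * r powr s / a"
  define ker where "ker u x = min 1 (?A * dist (X u \<omega>) x powr (- s))" for u x
  have A: "0 < ?A" using assms by simp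
  have "0 \<le> ker u x" for u x
    unfolding ker_def min.bounded_iff using less_imp_le[OF A]
    by (intro conjI mult_nonneg_nonneg powr_ge_zero zero_le_one)
  moreover have "ker u x \<le> 1" for u x by (simp add: ker_def)
  moreover have "ker u \<in> borel_measurable location_law" for u unfolding ker_def by measurable
  ultimately have ker_int: "integrable location_law (ker u)" for u
    by (intro L.integrable_const_bound[where B = 1] AE_I2) (simp_all add: abs_of_nonneg)
  have ker_le: "(\<integral>x. ker u x \<partial>location_law) \<le> c * ?A powr (real CARD('d) / s)" for u
    unfolding ker_def by (rule kernel[OF A])
  have damp_int: "integrable location_law (\<lambda>x. \<Prod>j<n. damp r x (X j \<omega>))"
    by (intro L.integrable_const_bound[where B = 1]) (auto simp: prod_damp_bounds abs_of_nonneg)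
  have lhs_int: "integrable location_law (\<lambda>x. \<Sum>u\<in>{0..m}. h (graph_degree (E m \<omega>) u) * attach_prob m \<omega> u x)"
  proof (intro Bochner_Integration.integrable_sum integrable_mult_right)
    fix u assume u: "u \<in> {0..m}"
    have "attach_prob m \<omega> u \<in> borel_measurable location_law"
      unfolding attach_prob_def gpa_weight_def by measurable
    then show "integrable location_law (attach_prob m \<omega> u)"
      using power_attach_prob_bounds u by (intro L.integrable_const_bound[where B = 1]) (auto simp: abs_of_nonneg)
  qed
  have "(\<integral>x. (\<Sum>u\<in>{0..m}. h (graph_degree (E m \<omega>) u) * attach_prob m \<omega> u x) \<partial>location_law)
    \<le> (\<integral>x. H * exp a * (\<Prod>j<n. damp r x (X j \<omega>)) + (\<Sum>u\<in>{0..m}. h (graph_degree (E m \<omega>) u) * ker u x) \<partial>location_law)"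
  proof (rule integral_mono_AE[OF lhs_int])
    show "integrable location_law (\<lambda>x. H * exp a * (\<Prod>j<n. damp r x (X j \<omega>))
        + (\<Sum>u\<in>{0..m}. h (graph_degree (E m \<omega>) u) * ker u x))"
      by (intro Bochner_Integration.integrable_add Bochner_Integration.integrable_sum
          integrable_mult_right damp_int ker_int)
    have "AE x in location_law. x \<notin> (\<lambda>j. X j \<omega>) ` {0..m}"
      by (rule AE_location_not_in_finite) simp
    then show "AE x in location_law. (\<Sum>u\<in>{0..m}. h (graph_degree (E m \<omega>) u) * attach_prob m \<omega> u x)
      \<le> H * exp a * (\<Prod>j<n. damp r x (X j \<omega>)) + (\<Sum>u\<in>{0..m}. h (graph_degree (E m \<omega>) u) * ker u x)"
      unfolding ker_def by eventually_elim (rule weighted_attach_prob_le[OF assms(2-6) _ h])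
  qed
  also have "\<dots> = H * exp a * void_mass n r \<omega>
      + (\<Sum>u\<in>{0..m}. h (graph_degree (E m \<omega>) u) * (\<integral>x. ker u x \<partial>location_law))"
    by (subst Bochner_Integration.integral_add)
      (auto intro!: Bochner_Integration.integrable_sum integrable_mult_right damp_int ker_int
        simp: void_mass_def Bochner_Integration.integral_sum ker_int)
  also have "\<dots> \<le> H * exp a * void_mass n r \<omega>
      + (\<Sum>u\<in>{0..m}. h (graph_degree (E m \<omega>) u) * (c * ?A powr (real CARD('d) / s)))"
    by (intro add_left_mono sum_mono mult_left_mono ker_le h)
  also have "?A powr (real CARD('d) / s) = (real k / a) powr (real CARD('d) / s) * r ^ CARD('d)"
    using assms s_pos by (simp add: powr_mult powr_divide powr_powr powr_realpow)
  finally show ?thesis by (simp only: sum_distrib_right mult.assoc)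
qed

end

section \<open>An exponential potential of the degrees\<close>

context gpa_graph
begin

text \<open>
  Truncating the degree at \<open>k\<close> keeps the summands bounded, which makes exponential moments finite and
  allows the crude estimate at sparse locations. The summand of a vertex of degree at least \<open>k\<close> is
  \<open>exp (\<theta> * k)\<close>, so the potential controls the number of these vertices.
\<close>

definition potential :: "real \<Rightarrow> nat \<Rightarrow> nat \<Rightarrow> 'w \<Rightarrow> real" where
  "potential \<theta> k n \<omega> = (\<Sum>u\<in>{0..n}. exp (\<theta> * real (min (graph_degree (E n \<omega>) u) k)))"

definition gain :: "real \<Rightarrow> nat \<Rightarrow> nat \<Rightarrow> real" where
  "gain \<theta> k j = exp (\<theta> * real (min (Suc j) k)) - exp (\<theta> * real (min j k))"

lemma gain_nonneg: "0 \<le> \<theta> \<Longrightarrow> 0 \<le> gain \<theta> k j"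
  by (auto simp: gain_def intro!: mult_left_mono)

lemma gain_eq_0: "k \<le> j \<Longrightarrow> gain \<theta> k j = 0"
  by (simp add: gain_def min_absorb2)

lemma gain_le_top:
  assumes "0 \<le> \<theta>"
  shows "gain \<theta> k j \<le> exp (\<theta> * real k)"
proof -
  have "exp (\<theta> * real (min (Suc j) k)) \<le> exp (\<theta> * real k)"
    using assms by (auto intro!: mult_left_mono)
  then show ?thesis unfolding gain_def using exp_ge_zero[of "\<theta> * real (min j k)"] by linarith
qed

lemma gain_le_potential_term:
  assumes "0 \<le> \<theta>"
  shows "gain \<theta> k j \<le> (exp \<theta> - 1) * exp (\<theta> * real (min j k))"
proof (cases "j < k")
  case True
  then show ?thesis by (simp add: gain_def min_absorb1 algebra_simps exp_add)
next
  case False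
  then show ?thesis using assms by (simp add: gain_eq_0)
qed

lemma potential_Suc:
  assumes "1 \<le> n" "\<omega> \<in> space M" "1 \<le> k"
  shows "potential \<theta> k (Suc n) \<omega>
    = potential \<theta> k n \<omega> + exp \<theta> + gain \<theta> k (graph_degree (E n \<omega>) (v (Suc n) \<omega>))"
proof -
  let ?\<phi> = "\<lambda>j. exp (\<theta> * real (min j k))" and ?d = "graph_degree (E n \<omega>)"
  have v: "v (Suc n) \<omega> \<in> {0..n}" by (rule v_vertex[OF assms(1,2)])
  have "(\<Sum>u\<in>{0..n}. ?\<phi> (graph_degree (E (Suc n) \<omega>) u))
    = (\<Sum>u\<in>{0..n}. ?\<phi> (?d u) + (if v (Suc n) \<omega> = u then gain \<theta> k (?d u) else 0))"
    by (intro sum.cong) (auto simp: graph_degree_Suc[OF assms(1,2)] gain_def)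
  also have "\<dots> = potential \<theta> k n \<omega> + gain \<theta> k (?d (v (Suc n) \<omega>))"
    using v by (simp add: sum.distrib potential_def)
  finally show ?thesis
    using assms(3)
    by (simp add: potential_def graph_degree_Suc[OF assms(1,2)] graph_degree_new[OF assms(1,2)])
qed

lemma potential_nonneg: "0 \<le> potential \<theta> k n \<omega>"
  unfolding potential_def by (intro sum_nonneg) simp

lemma potential_le:
  assumes "0 \<le> \<theta>"
  shows "potential \<theta> k n \<omega> \<le> real (Suc n) * exp (\<theta> * real k)"
proof -
  have "potential \<theta> k n \<omega> \<le> (\<Sum>u\<in>{0..n}. exp (\<theta> * real k))"
    unfolding potential_def using assms by (intro sum_mono) (auto intro!: mult_left_mono)
  then show ?thesis by simp
qed

lemma num_degree_ge_le_potential: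
  "real (num_degree_ge n (E n \<omega>) k) * exp (\<theta> * real k) \<le> potential \<theta> k n \<omega>"
proof -
  let ?U = "{u \<in> {0..n}. k \<le> graph_degree (E n \<omega>) u}"
  have "real (num_degree_ge n (E n \<omega>) k) * exp (\<theta> * real k)
    = (\<Sum>u\<in>?U. exp (\<theta> * real (min (graph_degree (E n \<omega>) u) k)))"
    by (simp add: num_degree_ge_def min_absorb2)
  also have "\<dots> \<le> potential \<theta> k n \<omega>"
    unfolding potential_def by (intro sum_mono2) auto
  finally show ?thesis .
qed

lemma potential_measurable_wrt:
  assumes "1 \<le> n" "n \<le> m"
  shows "potential \<theta> k n \<in> borel_measurable (gpa_sigma M E X m m)"
  unfolding potential_def
  by (intro borel_measurable_sum measurable_compose[OF edges_measurable_later[OF assms]]) simp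

lemma potential_measurable [measurable]: "1 \<le> n \<Longrightarrow> potential \<theta> k n \<in> borel_measurable M"
  by (rule measurable_from_subalg[OF subalgebra_gpa_sigma[where m = n] potential_measurable_wrt[where m = n]])
    simp_all

lemma sum_gain_le:
  assumes "0 \<le> \<theta>"
  shows "(\<Sum>u\<in>{0..n}. gain \<theta> k (graph_degree (E n \<omega>) u)) \<le> (exp \<theta> - 1) * potential \<theta> k n \<omega>"
  unfolding potential_def sum_distrib_left using assms by (intro sum_mono gain_le_potential_term)

end

lemma exp_le_one_plus_twice:
  fixes x :: real
  assumes "0 \<le> x" "x \<le> 1"
  shows "exp x \<le> 1 + 2 * x"
proof -
  have "x\<^sup>2 \<le> x" using assms by (simp add: power2_eq_square mult_left_le)
  then show ?thesis using exp_bound[of x] assms by simp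
qed

context power_law_gpa
begin

lemma integrable_weighted_exp_potential:
  assumes "1 \<le> m" "W \<in> borel_measurable M" "\<And>\<omega>. \<omega> \<in> space M \<Longrightarrow> \<bar>W \<omega>\<bar> \<le> B"
    "0 \<le> \<theta>" "0 \<le> \<mu>"
  shows "integrable M (\<lambda>\<omega>. W \<omega> * exp (\<mu> * potential \<theta> k m \<omega>))"
proof (rule integrable_const_bound)
  note [measurable] = assms(2) potential_measurable[OF assms(1)]
  show "(\<lambda>\<omega>. W \<omega> * exp (\<mu> * potential \<theta> k m \<omega>)) \<in> borel_measurable M" by measurable
  show "AE \<omega> in M. norm (W \<omega> * exp (\<mu> * potential \<theta> k m \<omega>)) \<le> B * exp (\<mu> * (real (Suc m) * exp (\<theta> * real k)))"
  proof (rule AE_I2)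
    fix \<omega> assume "\<omega> \<in> space M"
    then have "\<bar>W \<omega>\<bar> * exp (\<mu> * potential \<theta> k m \<omega>) \<le> B * exp (\<mu> * (real (Suc m) * exp (\<theta> * real k)))"
      using assms potential_le[OF assms(4), of k m \<omega>]
      by (intro mult_mono) (auto intro: mult_left_mono order_trans[OF abs_ge_zero])
    then show "norm (W \<omega> * exp (\<mu> * potential \<theta> k m \<omega>)) \<le> B * exp (\<mu> * (real (Suc m) * exp (\<theta> * real k)))"
      by (simp add: abs_mult)
  qed
qed

text \<open>
  The increment of the potential is \<open>exp \<theta>\<close> from the new vertex plus the gain \<open>g\<close> of the vertex it
  attaches to, and the conditional mean of \<open>g\<close> is at most \<open>\<eta> + \<alpha> * \<Phi>\<close> where \<open>W\<close> is not 0. Since \<open>t * g \<le> 1\<close>, the estimates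
  \<open>exp (t * g) \<le> 1 + 2 * t * g\<close> and \<open>1 + x \<le> exp x\<close> turn this bound on the mean into one on the exponential
  moment, at the price of a factor 2. The term \<open>\<alpha> * \<Phi>\<close> reappears in the exponent, as an increase of the
  parameter from \<open>t\<close> to \<open>t * (1 + 2 * \<alpha>)\<close>. The weight \<open>W\<close> plays the part of conditioning on the past.
\<close>

lemma exp_potential_step:
  assumes kernel: "\<And>A y. 0 < A \<Longrightarrow>
      (\<integral>x. min 1 (A * dist y x powr (- s)) \<partial>location_law) \<le> c * A powr (real CARD('d) / s)"
    and m: "1 \<le> m" "n \<le> Suc m" and r: "0 < r" and a: "0 < a" and k: "1 \<le> k" and \<theta>: "0 \<le> \<theta>"
    and t: "0 \<le> t" "t * exp (\<theta> * real k) \<le> 1"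
    and W [measurable]: "W \<in> borel_measurable (gpa_sigma M E X m m)"
    and W_bounds: "\<And>\<omega>. \<omega> \<in> space M \<Longrightarrow> 0 \<le> W \<omega>" "\<And>\<omega>. \<omega> \<in> space M \<Longrightarrow> W \<omega> \<le> B"
    and good: "\<And>\<omega>. \<omega> \<in> space M \<Longrightarrow> W \<omega> \<noteq> 0 \<Longrightarrow> exp (\<theta> * real k) * exp a * void_mass n r \<omega> \<le> \<eta>"
    and \<alpha>: "\<alpha> = (exp \<theta> - 1) * (c * (real k / a) powr (real CARD('d) / s) * r ^ CARD('d))"
    and c: "0 \<le> c"
  shows "(\<integral>\<omega>. W \<omega> * exp (t * potential \<theta> k (Suc m) \<omega>) \<partial>M)
    \<le> exp (t * (exp \<theta> + 2 * \<eta>)) * (\<integral>\<omega>. W \<omega> * exp (t * (1 + 2 * \<alpha>) * potential \<theta> k m \<omega>) \<partial>M)"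
proof -
  define g where "g = gain \<theta> k"
  define \<Phi> where "\<Phi> = potential \<theta> k m"
  define W' where "W' \<omega> = W \<omega> * exp (t * \<Phi> \<omega> + t * exp \<theta>)" for \<omega>
  let ?deg = "\<lambda>\<omega>. graph_degree (E m \<omega>) (v (Suc m) \<omega>)"
  let ?drift = "\<lambda>\<omega>. \<integral>x. (\<Sum>u\<in>{0..m}. g (graph_degree (E m \<omega>) u) * attach_prob m \<omega> u x) \<partial>location_law"
  have g: "0 \<le> g j" "g j \<le> exp (\<theta> * real k)" "k \<le> j \<Longrightarrow> g j = 0" for j
    using \<theta> by (auto simp: g_def gain_nonneg gain_le_top gain_eq_0)
  have \<alpha>0: "0 \<le> \<alpha>" unfolding \<alpha> using \<theta> c r by simp
  have \<Phi>_meas [measurable]: "\<Phi> \<in> borel_measurable (gpa_sigma M E X m m)"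
    unfolding \<Phi>_def by (rule potential_measurable_wrt) (use m in simp_all)
  have sub: "subalgebra M (gpa_sigma M E X m m)" by (rule subalgebra_gpa_sigma[OF m(1)])
  have W'_meas [measurable]: "W' \<in> borel_measurable (gpa_sigma M E X m m)"
    unfolding W'_def by measurable
  note [measurable] = measurable_from_subalg[OF sub W] measurable_from_subalg[OF sub W'_meas]
    measurable_from_subalg[OF sub \<Phi>_meas] v_measurable[OF m(1)] E_measurable[OF m(1)]
  define B' where "B' = B * exp (t * (real (Suc m) * exp (\<theta> * real k)) + t * exp \<theta>)"
  have W'_bounds: "0 \<le> W' \<omega>" "W' \<omega> \<le> B'" if "\<omega> \<in> space M" for \<omega>
  proof -
    show "0 \<le> W' \<omega>" using W_bounds[OF that] by (simp add: W'_def)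
    show "W' \<omega> \<le> B'"
      unfolding W'_def B'_def using W_bounds[OF that] potential_le[OF \<theta>, of k m \<omega>] t
      by (intro mult_mono) (auto simp: \<Phi>_def intro: mult_left_mono)
  qed
  have W'_int: "integrable M W'"
    using W'_bounds by (intro integrable_const_bound[where B = B'] AE_I2) (auto simp: abs_of_nonneg)
  have deg_meas: "(\<lambda>\<omega>. g (?deg \<omega>)) \<in> borel_measurable M"
  proof (rule measurable_compose_countable[OF _ v_measurable[OF m(1)]])
    show "(\<lambda>\<omega>. g (graph_degree (E m \<omega>) u)) \<in> borel_measurable M" for u
      by (rule measurable_compose[OF E_measurable[OF m(1)]]) simp
  qed
  have W'g_int: "integrable M (\<lambda>\<omega>. W' \<omega> * g (?deg \<omega>))"
  proof (rule Bochner_Integration.integrable_bound[OF integrable_mult_left[OF W'_int, of "exp (\<theta> * real k)"]])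
    show "(\<lambda>\<omega>. W' \<omega> * g (?deg \<omega>)) \<in> borel_measurable M" using deg_meas by measurable
    show "AE \<omega> in M. norm (W' \<omega> * g (?deg \<omega>)) \<le> norm (W' \<omega> * exp (\<theta> * real k))"
      using g by (intro AE_I2) (auto simp: abs_mult intro!: mult_left_mono)
  qed
  have drift: "W' \<omega> * ?drift \<omega> \<le> W' \<omega> * (\<eta> + \<alpha> * \<Phi> \<omega>)" if \<omega>: "\<omega> \<in> space M" for \<omega>
  proof (cases "W \<omega> = 0")
    case False
    let ?K = "c * (real k / a) powr (real CARD('d) / s) * r ^ CARD('d)"
    have "?drift \<omega> \<le> exp (\<theta> * real k) * exp a * void_mass n r \<omega> + (\<Sum>u\<in>{0..m}. g (graph_degree (E m \<omega>) u)) * ?K"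
      by (rule expected_weight_attached_le[OF kernel m \<omega> r a k g])
    also have "\<dots> \<le> \<eta> + ((exp \<theta> - 1) * \<Phi> \<omega>) * ?K"
      using good[OF \<omega> False] sum_gain_le[OF \<theta>, of k m \<omega>] c r
      by (intro add_mono mult_right_mono) (auto simp: g_def \<Phi>_def)
    also have "\<dots> = \<eta> + \<alpha> * \<Phi> \<omega>" by (simp add: \<alpha>)
    finally show ?thesis using W'_bounds[OF \<omega>] by (intro mult_left_mono) auto
  qed (simp add: W'_def)
  have W'\<Phi>_int: "integrable M (\<lambda>\<omega>. W' \<omega> * (\<eta> + \<alpha> * \<Phi> \<omega>))"
  proof (rule Bochner_Integration.integrable_bound)
    show "integrable M (\<lambda>\<omega>. W' \<omega> * (\<bar>\<eta>\<bar> + \<alpha> * (real (Suc m) * exp (\<theta> * real k))))"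
      by (rule integrable_mult_left[OF W'_int])
    show "(\<lambda>\<omega>. W' \<omega> * (\<eta> + \<alpha> * \<Phi> \<omega>)) \<in> borel_measurable M" by measurable
    show "AE \<omega> in M. norm (W' \<omega> * (\<eta> + \<alpha> * \<Phi> \<omega>))
        \<le> norm (W' \<omega> * (\<bar>\<eta>\<bar> + \<alpha> * (real (Suc m) * exp (\<theta> * real k))))"
    proof (rule AE_I2)
      fix \<omega>
      have "\<alpha> * \<Phi> \<omega> \<le> \<alpha> * (real (Suc m) * exp (\<theta> * real k))"
        unfolding \<Phi>_def using \<alpha>0 potential_le[OF \<theta>] by (intro mult_left_mono)
      moreover have "0 \<le> \<alpha> * \<Phi> \<omega>" using \<alpha>0 by (simp add: \<Phi>_def potential_nonneg)
      ultimately have "\<bar>\<eta> + \<alpha> * \<Phi> \<omega>\<bar> \<le> \<bar>\<bar>\<eta>\<bar> + \<alpha> * (real (Suc m) * exp (\<theta> * real k))\<bar>" by linarith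
      then show "norm (W' \<omega> * (\<eta> + \<alpha> * \<Phi> \<omega>))
          \<le> norm (W' \<omega> * (\<bar>\<eta>\<bar> + \<alpha> * (real (Suc m) * exp (\<theta> * real k))))"
        unfolding real_norm_def abs_mult by (intro mult_left_mono) simp_all
    qed
  qed
  have drift_int_le: "(\<integral>\<omega>. W' \<omega> * ?drift \<omega> \<partial>M) \<le> (\<integral>\<omega>. W' \<omega> * (\<eta> + \<alpha> * \<Phi> \<omega>) \<partial>M)"
  proof (rule integral_mono'[OF W'\<Phi>_int drift])
    fix \<omega> assume \<omega>: "\<omega> \<in> space M"
    have "0 \<le> ?drift \<omega>"
      using g power_attach_prob_bounds by (intro integral_nonneg_AE AE_I2 sum_nonneg mult_nonneg_nonneg) auto
    then have "0 \<le> W' \<omega> * ?drift \<omega>" using W'_bounds[OF \<omega>] by simp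
    then show "0 \<le> W' \<omega> * (\<eta> + \<alpha> * \<Phi> \<omega>)" using drift[OF \<omega>] by simp
  qed
  have "(\<integral>\<omega>. W \<omega> * exp (t * potential \<theta> k (Suc m) \<omega>) \<partial>M) \<le> (\<integral>\<omega>. W' \<omega> + 2 * t * (W' \<omega> * g (?deg \<omega>)) \<partial>M)"
  proof (rule integral_mono)
    show "integrable M (\<lambda>\<omega>. W \<omega> * exp (t * potential \<theta> k (Suc m) \<omega>))"
      using W_bounds \<theta> t by (intro integrable_weighted_exp_potential[where B = B]) (auto simp: abs_of_nonneg)
    show "integrable M (\<lambda>\<omega>. W' \<omega> + 2 * t * (W' \<omega> * g (?deg \<omega>)))"
      by (intro Bochner_Integration.integrable_add integrable_mult_right W'_int W'g_int)
    fix \<omega> assume \<omega>: "\<omega> \<in> space M"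
    have "t * g (?deg \<omega>) \<le> t * exp (\<theta> * real k)" using t g by (intro mult_left_mono)
    then have "exp (t * g (?deg \<omega>)) \<le> 1 + 2 * (t * g (?deg \<omega>))"
      using t g by (intro exp_le_one_plus_twice) auto
    then have "W' \<omega> * exp (t * g (?deg \<omega>)) \<le> W' \<omega> * (1 + 2 * (t * g (?deg \<omega>)))"
      using W'_bounds[OF \<omega>] by (intro mult_left_mono)
    then show "W \<omega> * exp (t * potential \<theta> k (Suc m) \<omega>) \<le> W' \<omega> + 2 * t * (W' \<omega> * g (?deg \<omega>))"
      unfolding potential_Suc[OF m(1) \<omega> k]
      by (simp add: W'_def \<Phi>_def g_def exp_add[symmetric] algebra_simps)
  qed
  also have "\<dots> = (\<integral>\<omega>. W' \<omega> \<partial>M) + 2 * t * (\<integral>\<omega>. W' \<omega> * g (?deg \<omega>) \<partial>M)"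
    by (subst Bochner_Integration.integral_add) (auto intro: W'_int W'g_int)
  also have "(\<integral>\<omega>. W' \<omega> * g (?deg \<omega>) \<partial>M) = (\<integral>\<omega>. W' \<omega> * ?drift \<omega> \<partial>M)"
    using W'_bounds g by (intro expectation_degree_attached[OF m(1), where B = B']) (auto simp: abs_of_nonneg)
  also have "(\<integral>\<omega>. W' \<omega> \<partial>M) + 2 * t * (\<integral>\<omega>. W' \<omega> * ?drift \<omega> \<partial>M)
      \<le> (\<integral>\<omega>. W' \<omega> \<partial>M) + 2 * t * (\<integral>\<omega>. W' \<omega> * (\<eta> + \<alpha> * \<Phi> \<omega>) \<partial>M)"
    using drift_int_le t by (intro add_left_mono mult_left_mono) auto
  also have "\<dots> = (\<integral>\<omega>. W' \<omega> + 2 * t * (W' \<omega> * (\<eta> + \<alpha> * \<Phi> \<omega>)) \<partial>M)"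
    by (subst Bochner_Integration.integral_add) (auto intro: W'_int W'\<Phi>_int)
  also have "\<dots> \<le> (\<integral>\<omega>. exp (t * (exp \<theta> + 2 * \<eta>)) * (W \<omega> * exp (t * (1 + 2 * \<alpha>) * potential \<theta> k m \<omega>)) \<partial>M)"
  proof (rule integral_mono)
    show "integrable M (\<lambda>\<omega>. W' \<omega> + 2 * t * (W' \<omega> * (\<eta> + \<alpha> * \<Phi> \<omega>)))"
      by (intro Bochner_Integration.integrable_add integrable_mult_right W'_int W'\<Phi>_int)
    show "integrable M (\<lambda>\<omega>. exp (t * (exp \<theta> + 2 * \<eta>)) * (W \<omega> * exp (t * (1 + 2 * \<alpha>) * potential \<theta> k m \<omega>)))"
      using W_bounds \<theta> t m \<alpha>0
      by (intro integrable_mult_right integrable_weighted_exp_potential[where B = B]) (auto simp: abs_of_nonneg)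
    fix \<omega> assume \<omega>: "\<omega> \<in> space M"
    have "W' \<omega> * (1 + 2 * t * (\<eta> + \<alpha> * \<Phi> \<omega>)) \<le> W' \<omega> * exp (2 * t * (\<eta> + \<alpha> * \<Phi> \<omega>))"
      using W'_bounds[OF \<omega>] by (intro mult_left_mono exp_ge_add_one_self)
    then show "W' \<omega> + 2 * t * (W' \<omega> * (\<eta> + \<alpha> * \<Phi> \<omega>))
        \<le> exp (t * (exp \<theta> + 2 * \<eta>)) * (W \<omega> * exp (t * (1 + 2 * \<alpha>) * potential \<theta> k m \<omega>))"
      by (simp add: W'_def \<Phi>_def exp_add[symmetric] algebra_simps)
  qed
  finally show ?thesis by simp
qed

text \<open>
  Going backwards from time \<open>n + j\<close> to time \<open>n\<close>, each step multiplies the parameter of the exponential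
  moment by \<open>1 + 2 * \<alpha>\<close>. This is why the parameter is generalized in the induction.
\<close>

lemma exp_potential_iterate:
  assumes kernel: "\<And>A y. 0 < A \<Longrightarrow>
      (\<integral>x. min 1 (A * dist y x powr (- s)) \<partial>location_law) \<le> c * A powr (real CARD('d) / s)"
    and n: "1 \<le> n" and r: "0 < r" and a: "0 < a" and k: "1 \<le> k" and \<theta>: "0 \<le> \<theta>"
    and W: "\<And>m. n \<le> m \<Longrightarrow> W \<in> borel_measurable (gpa_sigma M E X m m)"
    and W_bounds: "\<And>\<omega>. \<omega> \<in> space M \<Longrightarrow> 0 \<le> W \<omega>" "\<And>\<omega>. \<omega> \<in> space M \<Longrightarrow> W \<omega> \<le> B"
    and good: "\<And>\<omega>. \<omega> \<in> space M \<Longrightarrow> W \<omega> \<noteq> 0 \<Longrightarrow> exp (\<theta> * real k) * exp a * void_mass n r \<omega> \<le> \<eta>"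
    and \<eta>: "0 \<le> \<eta>"
    and \<alpha>: "\<alpha> = (exp \<theta> - 1) * (c * (real k / a) powr (real CARD('d) / s) * r ^ CARD('d))"
    and c: "0 \<le> c"
    and t: "0 \<le> t" "t * (1 + 2 * \<alpha>) ^ j * exp (\<theta> * real k) \<le> 1"
  shows "(\<integral>\<omega>. W \<omega> * exp (t * potential \<theta> k (n + j) \<omega>) \<partial>M)
    \<le> exp (t * (1 + 2 * \<alpha>) ^ j * real j * (exp \<theta> + 2 * \<eta>))
      * (\<integral>\<omega>. W \<omega> * exp (t * (1 + 2 * \<alpha>) ^ j * potential \<theta> k n \<omega>) \<partial>M)"
  using t
proof (induction j arbitrary: t)
  case 0
  then show ?case by simp
next
  case (Suc j)
  let ?\<rho> = "1 + 2 * \<alpha>" and ?\<kappa> = "exp \<theta> + 2 * \<eta>"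
  have \<alpha>0: "0 \<le> \<alpha>" unfolding \<alpha> using \<theta> c r by simp
  have \<rho>: "1 \<le> ?\<rho>" "1 \<le> ?\<rho> ^ Suc j" using \<alpha>0 by (auto simp del: power_Suc)
  have tle: "t \<le> t * ?\<rho> ^ Suc j" using Suc.prems(1) \<rho>(2) by (metis mult_left_mono mult.right_neutral)
  have small: "t * exp (\<theta> * real k) \<le> 1"
    using tle Suc.prems(2) by (meson exp_ge_zero mult_right_mono order_trans)
  have \<kappa>: "0 \<le> ?\<kappa>" using \<eta> by (simp add: add_nonneg_nonneg)
  have nonneg: "0 \<le> (\<integral>\<omega>. W \<omega> * exp (t * ?\<rho> ^ Suc j * potential \<theta> k n \<omega>) \<partial>M)"
    using W_bounds by (intro Bochner_Integration.integral_nonneg) auto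
  have "(\<integral>\<omega>. W \<omega> * exp (t * potential \<theta> k (n + Suc j) \<omega>) \<partial>M)
    \<le> exp (t * ?\<kappa>) * (\<integral>\<omega>. W \<omega> * exp (t * ?\<rho> * potential \<theta> k (n + j) \<omega>) \<partial>M)"
    using n unfolding add_Suc_right
    by (intro exp_potential_step[OF kernel _ _ r a k \<theta> Suc.prems(1) small W W_bounds good \<alpha> c]) auto
  also have "\<dots> \<le> exp (t * ?\<kappa>) * (exp (t * ?\<rho> * ?\<rho> ^ j * real j * ?\<kappa>)
      * (\<integral>\<omega>. W \<omega> * exp (t * ?\<rho> * ?\<rho> ^ j * potential \<theta> k n \<omega>) \<partial>M))"
    using Suc.prems \<rho> by (intro mult_left_mono Suc.IH) (auto simp: mult_ac)
  also have "\<dots> = exp (t * ?\<kappa> + t * ?\<rho> ^ Suc j * real j * ?\<kappa>)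
      * (\<integral>\<omega>. W \<omega> * exp (t * ?\<rho> ^ Suc j * potential \<theta> k n \<omega>) \<partial>M)"
    by (simp add: exp_add mult.assoc)
  also have "\<dots> \<le> exp (t * ?\<rho> ^ Suc j * real (Suc j) * ?\<kappa>)
      * (\<integral>\<omega>. W \<omega> * exp (t * ?\<rho> ^ Suc j * potential \<theta> k n \<omega>) \<partial>M)"
  proof (rule mult_right_mono[OF _ nonneg])
    have "t * ?\<kappa> \<le> t * ?\<rho> ^ Suc j * ?\<kappa>" using tle \<kappa> by (rule mult_right_mono)
    then show "exp (t * ?\<kappa> + t * ?\<rho> ^ Suc j * real j * ?\<kappa>) \<le> exp (t * ?\<rho> ^ Suc j * real (Suc j) * ?\<kappa>)"
      by (simp add: algebra_simps del: power_Suc)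
  qed
  finally show ?case .
qed

text \<open>
  Markov's inequality for \<open>exp (t * \<Phi> (2 * n))\<close>, where \<open>t\<close> is two thirds of the largest admissible
  parameter, so that the parameter is still admissible after it has grown by the factor
  \<open>(1 + 2 * \<alpha>) ^ n \<le> 3 / 2\<close>. The weight \<open>W\<close> restricts to small void mass and divides by the exponential of
  the initial potential, which makes the expectation at time \<open>n\<close> at most 1. The accumulated additive
  drift is at most \<open>3 / 2 * 7 * n\<close>, and the threshold \<open>12 * n\<close> exceeds it by \<open>3 / 2 * n\<close>.
\<close>

lemma prob_potential_doubling:
  assumes kernel: "\<And>A y. 0 < A \<Longrightarrow>
      (\<integral>x. min 1 (A * dist y x powr (- s)) \<partial>location_law) \<le> c * A powr (real CARD('d) / s)"
    and n: "1 \<le> n" and r: "0 < r" and a: "0 < a" and k: "1 \<le> k" and \<theta>: "0 \<le> \<theta>"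
    and q: "exp (\<theta> * real k) * exp a * q \<le> \<eta>"
    and \<eta>: "0 \<le> \<eta>" "exp \<theta> + 2 * \<eta> \<le> 7"
    and \<alpha>: "\<alpha> = (exp \<theta> - 1) * (c * (real k / a) powr (real CARD('d) / s) * r ^ CARD('d))"
    and c: "0 \<le> c"
    and growth: "(1 + 2 * \<alpha>) ^ n \<le> 3 / 2"
  shows "prob {\<omega> \<in> space M. void_mass n r \<omega> < q \<and>
      3 / 2 * potential \<theta> k n \<omega> + 12 * real n \<le> potential \<theta> k (2 * n) \<omega>}
    \<le> exp (- (exp (- (\<theta> * real k)) * real n))" (is "prob ?A \<le> _")
proof -
  (* The parameter p at time n then satisfies p * exp (\<theta> * k) \<le> 1. *)
  define t where "t = 2 / 3 * exp (- (\<theta> * real k))"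
  define p where "p = t * (1 + 2 * \<alpha>) ^ n"
  define W where "W \<omega> = indicator {\<omega>. void_mass n r \<omega> < q} \<omega> * exp (- (p * potential \<theta> k n \<omega>))" for \<omega>
  have t: "0 < t" by (simp add: t_def)
  have \<alpha>0: "0 \<le> \<alpha>" unfolding \<alpha> using \<theta> c r by simp
  have p: "0 \<le> p" "p \<le> 3 / 2 * t"
    using t \<alpha>0 growth by (auto simp: p_def mult.commute)
  have small: "p * exp (\<theta> * real k) \<le> 1"
  proof -
    have "p * exp (\<theta> * real k) \<le> 3 / 2 * t * exp (\<theta> * real k)"
      using p by (intro mult_right_mono) simp_all
    also have "\<dots> = 1" by (simp add: t_def exp_minus)
    finally show ?thesis .
  qed
  have W_bounds: "0 \<le> W \<omega>" "W \<omega> \<le> 1" for \<omega>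
    using p potential_nonneg[of \<theta> k n \<omega>] by (auto simp: W_def indicator_def)
  have W_meas: "W \<in> borel_measurable (gpa_sigma M E X m m)" if "n \<le> m" for m
  proof -
    have [measurable]: "void_mass n r \<in> borel_measurable (gpa_sigma M E X m m)"
      using that by (intro void_mass_measurable_wrt gpa_sigma_points) simp
    have [measurable]: "potential \<theta> k n \<in> borel_measurable (gpa_sigma M E X m m)"
      using n that by (rule potential_measurable_wrt)
    show ?thesis unfolding W_def indicator_def mem_Collect_eq by measurable
  qed
  have good: "exp (\<theta> * real k) * exp a * void_mass n r \<omega> \<le> \<eta>" if "W \<omega> \<noteq> 0" for \<omega>
  proof -
    have "void_mass n r \<omega> \<le> q" using that by (simp add: W_def indicator_def split: if_splits)
    then have "exp (\<theta> * real k) * exp a * void_mass n r \<omega> \<le> exp (\<theta> * real k) * exp a * q"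
      by (rule mult_left_mono) simp
    then show ?thesis using q by (rule order_trans)
  qed
  have n2: "1 \<le> 2 * n" using n by simp
  note [measurable] = potential_measurable[OF n] potential_measurable[OF n2]
    measurable_from_subalg[OF subalgebra_gpa_sigma[OF n] W_meas[OF order_refl]]
  have A_meas [measurable]: "?A \<in> sets M" by measurable
  have int2: "integrable M (\<lambda>\<omega>. W \<omega> * exp (t * potential \<theta> k (2 * n) \<omega>))"
    using n \<theta> t W_bounds
    by (intro integrable_weighted_exp_potential[where B = 1]) (auto simp: abs_of_nonneg)
  have int1: "integrable M (\<lambda>\<omega>. W \<omega> * exp (p * potential \<theta> k n \<omega>))"
    using n \<theta> p W_bounds
    by (intro integrable_weighted_exp_potential[where B = 1]) (auto simp: abs_of_nonneg)
  have "prob ?A = (\<integral>\<omega>. indicator ?A \<omega> \<partial>M)" by simp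
  also have "\<dots> \<le> (\<integral>\<omega>. exp (- (12 * t * real n)) * (W \<omega> * exp (t * potential \<theta> k (2 * n) \<omega>)) \<partial>M)"
  proof (rule integral_mono)
    show "integrable M (indicator ?A :: 'w \<Rightarrow> real)"
      by (intro integrable_real_indicator) (simp_all add: emeasure_eq_measure)
    show "integrable M (\<lambda>\<omega>. exp (- (12 * t * real n)) * (W \<omega> * exp (t * potential \<theta> k (2 * n) \<omega>)))"
      by (intro integrable_mult_right int2)
    fix \<omega> assume \<omega>: "\<omega> \<in> space M"
    show "indicator ?A \<omega> \<le> exp (- (12 * t * real n)) * (W \<omega> * exp (t * potential \<theta> k (2 * n) \<omega>))"
    proof (cases "\<omega> \<in> ?A")
      case True
      have "p * potential \<theta> k n \<omega> \<le> 3 / 2 * t * potential \<theta> k n \<omega>"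
        using p potential_nonneg by (intro mult_right_mono) auto
      moreover have "t * (3 / 2 * potential \<theta> k n \<omega> + 12 * real n) \<le> t * potential \<theta> k (2 * n) \<omega>"
        using True t by (intro mult_left_mono) auto
      ultimately have "0 \<le> - (12 * t * real n) + (- (p * potential \<theta> k n \<omega>) + t * potential \<theta> k (2 * n) \<omega>)"
        by (simp add: algebra_simps)
      then have "1 \<le> exp (- (12 * t * real n) + (- (p * potential \<theta> k n \<omega>) + t * potential \<theta> k (2 * n) \<omega>))"
        by simp
      then show ?thesis using True by (simp only: exp_add) (simp add: W_def)
    next
      case False
      then show ?thesis using W_bounds by simp
    qed
  qed
  also have "\<dots> = exp (- (12 * t * real n)) * (\<integral>\<omega>. W \<omega> * exp (t * potential \<theta> k (n + n) \<omega>) \<partial>M)"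
    by (simp add: mult_2)
  also have "\<dots> \<le> exp (- (12 * t * real n)) * (exp (p * real n * (exp \<theta> + 2 * \<eta>))
      * (\<integral>\<omega>. W \<omega> * exp (p * potential \<theta> k n \<omega>) \<partial>M))"
    unfolding p_def
    by (intro mult_left_mono exp_potential_iterate[OF kernel n r a k \<theta> W_meas W_bounds good \<eta>(1) \<alpha> c])
      (use t small in \<open>auto simp: p_def\<close>)
  also have "(\<integral>\<omega>. W \<omega> * exp (p * potential \<theta> k n \<omega>) \<partial>M) \<le> (\<integral>\<omega>. 1 \<partial>M)"
    using int1 by (intro integral_mono) (auto simp: W_def exp_minus indicator_def)
  also have "(\<integral>\<omega>. 1 \<partial>M) = (1 :: real)" by (simp add: prob_space)
  also have "exp (p * real n * (exp \<theta> + 2 * \<eta>)) \<le> exp (3 / 2 * t * real n * 7)"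
    using p \<eta> by (subst exp_le_cancel_iff) (intro mult_mono, auto)
  finally have "prob ?A \<le> exp (- (12 * t * real n)) * (exp (3 / 2 * t * real n * 7) * 1)" by simp
  also have "\<dots> = exp (- (exp (- (\<theta> * real k)) * real n))"
    by (simp add: exp_add[symmetric] t_def)
  finally show ?thesis .
qed

end

section \<open>Growth along powers of two\<close>

text \<open>
  The fixed point of \<open>x \<mapsto> 3 / 4 * x + 6\<close> is 24, so any larger number is an eventual bound.
\<close>

lemma contraction_eventually_le:
  fixes A :: "nat \<Rightarrow> real"
  assumes "eventually (\<lambda>i. A (Suc i) \<le> 3 / 4 * A i + 6) sequentially"
  shows "eventually (\<lambda>i. A i \<le> 25) sequentially"
proof -
  obtain N where N: "\<And>i. N \<le> i \<Longrightarrow> A (Suc i) \<le> 3 / 4 * A i + 6"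
    using assms by (auto simp: eventually_sequentially)
  have bound: "A (j + N) \<le> (3 / 4) ^ j * (A N - 24) + 24" for j
  proof (induction j)
    case (Suc j)
    then show ?case using N[of "j + N"] by simp
  qed simp
  have "(\<lambda>j. (3 / 4) ^ j * (A N - 24) + 24) \<longlonglongrightarrow> 0 * (A N - 24) + 24"
    by (intro tendsto_intros LIMSEQ_power_zero) simp
  then have "eventually (\<lambda>j. (3 / 4) ^ j * (A N - 24) + 24 < 25) sequentially"
    by (rule order_tendstoD) simp
  then have "eventually (\<lambda>j. A (j + N) \<le> 25) sequentially"
    by eventually_elim (use bound in \<open>meson less_imp_le order_trans\<close>)
  then show ?thesis by (rule eventually_sequentially_seg[THEN iffD1])
qed

text \<open>
  This is a form of reverse Fatou: the excess \<open>max 0 (Y n - B)\<close> is bounded and tends to 0 almost surely.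
\<close>

lemma (in prob_space) limsup_expectation_le:
  fixes Y :: "nat \<Rightarrow> 'a \<Rightarrow> real"
  assumes [measurable]: "\<And>n. Y n \<in> borel_measurable M"
    and bounds: "\<And>n \<omega>. \<omega> \<in> space M \<Longrightarrow> 0 \<le> Y n \<omega>" "\<And>n \<omega>. \<omega> \<in> space M \<Longrightarrow> Y n \<omega> \<le> D"
    and B: "0 \<le> B" and ev: "AE \<omega> in M. eventually (\<lambda>n. Y n \<omega> \<le> B) sequentially"
  shows "limsup (\<lambda>n. ereal (expectation (Y n))) \<le> ereal B"
proof -
  define Z where "Z n \<omega> = max 0 (Y n \<omega> - B)" for n \<omega>
  have [measurable]: "Z n \<in> borel_measurable M" for n unfolding Z_def by measurable
  have Z_bound: "AE \<omega> in M. norm (Z n \<omega>) \<le> D" for n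
  proof (rule AE_I2)
    fix \<omega> assume "\<omega> \<in> space M"
    from bounds[OF this, of n] B show "norm (Z n \<omega>) \<le> D" by (simp add: Z_def)
  qed
  have Z_int: "integrable M (Z n)" for n by (rule integrable_const_bound[OF Z_bound]) measurable
  have "(\<lambda>n. expectation (Z n)) \<longlonglongrightarrow> expectation (\<lambda>_. 0)"
  proof (rule integral_dominated_convergence[where w = "\<lambda>_. D"])
    show "AE \<omega> in M. (\<lambda>n. Z n \<omega>) \<longlonglongrightarrow> 0"
      using ev
    proof eventually_elim
      fix \<omega> assume "eventually (\<lambda>n. Y n \<omega> \<le> B) sequentially"
      then have "eventually (\<lambda>n. Z n \<omega> = 0) sequentially" by eventually_elim (simp add: Z_def)
      then show "(\<lambda>n. Z n \<omega>) \<longlonglongrightarrow> 0" by (rule tendsto_eventually)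
    qed
  qed (use Z_bound in simp_all)
  then have lim: "(\<lambda>n. ereal (B + expectation (Z n))) \<longlonglongrightarrow> ereal (B + 0)"
    by (intro tendsto_intros) simp
  have "expectation (Y n) \<le> B + expectation (Z n)" for n
  proof -
    have "expectation (Y n) \<le> expectation (\<lambda>\<omega>. B + Z n \<omega>)"
    proof (rule integral_mono)
      show "integrable M (Y n)"
        using bounds by (intro integrable_const_bound[where B = D] AE_I2) (auto simp: abs_of_nonneg)
      show "integrable M (\<lambda>\<omega>. B + Z n \<omega>)" using Z_int by simp
    qed (simp add: Z_def)
    also have "\<dots> = B + expectation (Z n)" using Z_int by (simp add: prob_space)
    finally show ?thesis .
  qed
  then have "limsup (\<lambda>n. ereal (expectation (Y n))) \<le> limsup (\<lambda>n. ereal (B + expectation (Z n)))"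
    by (intro Limsup_mono always_eventually) simp
  also have "\<dots> = ereal B" using lim_imp_Limsup[OF _ lim] by simp
  finally show ?thesis .
qed

text \<open>
  The condition on \<open>\<gamma>\<close> is exactly that the rate \<open>k powr (2 * \<gamma> - 1 + (1 - \<gamma>) * (d / s))\<close>, at which the
  logarithm of the potential grows per doubling of \<open>n\<close>, vanishes for large \<open>k\<close>.
\<close>

lemma log_growth_exponent_neg:
  fixes d s \<gamma> :: real
  assumes "0 < d" "d < s" "\<gamma> < (s - d) / (2 * s - d)"
  shows "2 * \<gamma> - 1 + (1 - \<gamma>) * (d / s) < 0"
proof -
  have "\<gamma> * (2 * s - d) < s - d" using assms by (simp add: field_simps)
  moreover have "(2 * \<gamma> - 1 + (1 - \<gamma>) * (d / s)) * s = \<gamma> * (2 * s - d) - (s - d)"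
    using assms by (simp add: field_simps)
  ultimately have "(2 * \<gamma> - 1 + (1 - \<gamma>) * (d / s)) * s < 0" by simp
  then show ?thesis using assms by (simp add: mult_less_0_iff)
qed

context power_law_gpa
begin

text \<open>
  The scales are chosen as follows, with \<open>a = k powr \<gamma>\<close>. The weight \<open>\<theta> = k powr (\<gamma> - 1)\<close> makes the
  largest summand of the potential \<open>exp (\<theta> * k) = exp a\<close>. A location counts as sparse if fewer than
  \<open>a\<close> points lie within distance \<open>r\<close>, where \<open>r\<close> is such that \<open>c * n * r ^ d = 2 * a\<close>. Then the void mass is
  typically at most \<open>2 * exp (- 2 * a)\<close>, and sparse locations contribute to the drift at most
  \<open>exp a * exp a * 2 * exp (- 2 * a) = 2\<close>. The growth rate per doubling is of order
  \<open>\<theta> * (k / a) powr (d / s) * a\<close>, which is the power of \<open>k\<close> in the hypothesis \<open>small\<close>.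
  
  Both exceptional events have summable probabilities along \<open>n = 2 ^ i\<close>, even though the bound for the
  void mass is only of order \<open>1 / n\<close>.
\<close>

lemma AE_potential_doubling:
  fixes \<gamma> :: real
  assumes kernel: "\<And>A y. 0 < A \<Longrightarrow>
      (\<integral>x. min 1 (A * dist y x powr (- s)) \<partial>location_law) \<le> c' * A powr (real CARD('d) / s)"
    and c': "0 \<le> c'"
    and void: "\<And>n r. 0 < r \<Longrightarrow> r \<le> R \<Longrightarrow>
      prob {\<omega> \<in> space M. 2 * exp (- (c * (real n * r ^ CARD('d)))) \<le> void_mass n r \<omega>}
        \<le> C * r ^ CARD('d) / (exp (- (c * (real n * r ^ CARD('d)))))\<^sup>2"
    and c: "0 < c" "0 \<le> C" "0 < R"
    and k: "1 \<le> k" and \<gamma>: "\<gamma> \<le> 1"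
    and small: "4 * c' / c * real k powr (2 * \<gamma> - 1 + (1 - \<gamma>) * (real CARD('d) / s)) \<le> 1 / 8"
  shows "AE \<omega> in M. eventually (\<lambda>i. potential (real k powr (\<gamma> - 1)) k (2 ^ Suc i) \<omega>
    \<le> 3 / 2 * potential (real k powr (\<gamma> - 1)) k (2 ^ i) \<omega> + 12 * 2 ^ i) sequentially"
proof -
  let ?d = "CARD('d)"
  define \<theta> where "\<theta> = real k powr (\<gamma> - 1)"
  define a where "a = real k powr \<gamma>"
  define T where "T = 2 * a / c"
  define q where "q = 2 * exp (- (2 * a))"
  define r where "r i = (T / 2 ^ i) powr (1 / real ?d)" for i :: nat
  have k0: "0 < real k" using k by simp
  have a: "0 < a" using k0 by (simp add: a_def)
  have T: "0 < T" using a c by (simp add: T_def)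
  have \<theta>: "0 \<le> \<theta>" "\<theta> \<le> 1"
    using powr_mono[of "\<gamma> - 1" 0 "real k"] k \<gamma> by (simp_all add: \<theta>_def)
  have \<theta>k: "\<theta> * real k = a" using k0 by (simp add: \<theta>_def a_def powr_diff)
  have r_pos: "0 < r i" for i using T by (simp add: r_def)
  have r_pow: "r i ^ ?d = T / 2 ^ i" for i
    using T by (simp add: r_def powr_realpow[symmetric] powr_powr)
  have cnr: "c * (real (2 ^ i) * r i ^ ?d) = 2 * a" for i using c by (simp add: r_pow T_def)
  have r_lim: "eventually (\<lambda>i. r i \<le> R) sequentially"
  proof -
    have "(\<lambda>i. T * (1 / 2) ^ i) \<longlonglongrightarrow> T * 0" by (intro tendsto_intros LIMSEQ_power_zero) simp
    then have "eventually (\<lambda>i. T * (1 / 2) ^ i < R ^ ?d) sequentially"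
      using c by (intro order_tendstoD) auto
    then show ?thesis
    proof eventually_elim
      case (elim i)
      then have "r i ^ ?d \<le> R ^ ?d" by (simp add: r_pow power_one_over)
      then show ?case using c r_pos by (simp add: power_mono_iff less_imp_le)
    qed
  qed
  define \<alpha> where "\<alpha> i = (exp \<theta> - 1) * (c' * (real k / a) powr (real ?d / s) * r i ^ ?d)" for i
  have \<alpha>0: "0 \<le> \<alpha> i" for i unfolding \<alpha>_def using \<theta> c' r_pos[of i] by simp
  have \<alpha>_le: "2 ^ i * \<alpha> i \<le> 1 / 8" for i
  proof -
    have "real k / a = real k powr (1 - \<gamma>)" using k0 by (simp add: a_def powr_diff)
    then have ka: "(real k / a) powr (real ?d / s) = real k powr ((1 - \<gamma>) * (real ?d / s))"
      by (simp add: powr_powr)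
    have "2 ^ i * \<alpha> i = (exp \<theta> - 1) * (c' * real k powr ((1 - \<gamma>) * (real ?d / s)) * T)"
      by (simp add: \<alpha>_def r_pow ka)
    also have "\<dots> \<le> (2 * \<theta>) * (c' * real k powr ((1 - \<gamma>) * (real ?d / s)) * T)"
      using exp_le_one_plus_twice[OF \<theta>] c' T by (intro mult_right_mono) auto
    also have "\<dots> = 4 * c' / c * (\<theta> * real k powr ((1 - \<gamma>) * (real ?d / s)) * a)"
      by (simp add: T_def)
    also have "\<theta> * real k powr ((1 - \<gamma>) * (real ?d / s)) * a
        = real k powr (2 * \<gamma> - 1 + (1 - \<gamma>) * (real ?d / s))"
      unfolding \<theta>_def a_def powr_add[symmetric] by (simp add: algebra_simps)
    finally show ?thesis using small by simp
  qed
  have growth: "(1 + 2 * \<alpha> i) ^ 2 ^ i \<le> 3 / 2" for i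
  proof -
    have "(1 + 2 * \<alpha> i) ^ 2 ^ i \<le> exp (2 * \<alpha> i) ^ 2 ^ i"
      using \<alpha>0 by (intro power_mono exp_ge_add_one_self) (simp add: add_nonneg_nonneg)
    also have "\<dots> = exp (2 * (2 ^ i * \<alpha> i))" by (simp add: exp_of_nat_mult[symmetric] mult_ac)
    also have "\<dots> \<le> exp (1 / 4)" using \<alpha>_le[of i] by simp
    also have "\<dots> \<le> 3 / 2" using exp_le_one_plus_twice[of "1 / 4"] by simp
    finally show ?thesis .
  qed
  define V where "V i = {\<omega> \<in> space M. q \<le> void_mass (2 ^ i) (r i) \<omega>}" for i
  define D where "D i = {\<omega> \<in> space M. void_mass (2 ^ i) (r i) \<omega> < q \<and>
      3 / 2 * potential \<theta> k (2 ^ i) \<omega> + 12 * real (2 ^ i) \<le> potential \<theta> k (2 * 2 ^ i) \<omega>}" for i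
  have pow1: "1 \<le> (2 :: nat) ^ i" "1 \<le> 2 * (2 :: nat) ^ i" for i by (auto simp: Suc_le_eq)
  have V_meas: "V i \<in> sets M" for i unfolding V_def by measurable
  have D_meas: "D i \<in> sets M" for i
  proof -
    note [measurable] = potential_measurable[OF pow1(1)] potential_measurable[OF pow1(2)]
    show ?thesis unfolding D_def by measurable
  qed
  \<comment> \<open>The two terms come from the void mass and from the exponential deviation bound, by \<open>exp (- y) \<le> 1 / y\<close>.\<close>
  define K where "K = C * T / (exp (- (2 * a)))\<^sup>2 + 1 / exp (- a)"
  have "eventually (\<lambda>i. norm (prob (V i \<union> D i)) \<le> K * (1 / 2) ^ i) sequentially"
    using r_lim
  proof eventually_elim
    fix i assume i: "r i \<le> R"
    have "prob (V i) \<le> C * (T / 2 ^ i) / (exp (- (2 * a)))\<^sup>2"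
      using void[OF r_pos i, of "2 ^ i", unfolded cnr, unfolded r_pow] unfolding V_def q_def .
    moreover have "prob (D i) \<le> exp (- (exp (- a) * real (2 ^ i)))"
      unfolding D_def \<theta>k[symmetric]
    proof (rule prob_potential_doubling[OF kernel pow1(1) r_pos a k \<theta>(1) _ _ _ \<alpha>_def c' growth])
      have "exp a * exp a * (2 * exp (- (2 * a))) = 2 * exp (a + a + - (2 * a))"
        by (simp only: exp_add)
      then show "exp (\<theta> * real k) * exp a * q \<le> 2" by (simp add: \<theta>k q_def)
      show "exp \<theta> + 2 * 2 \<le> 7" using exp_le_one_plus_twice[OF \<theta>] \<theta> by simp
    qed simp_all
    moreover have "exp (- (exp (- a) * real (2 ^ i))) \<le> 1 / (exp (- a) * 2 ^ i)"
    proof -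
      have "exp (- y) \<le> 1 / y" if "0 < y" for y :: real
      proof -
        have "y \<le> exp y" using exp_ge_add_one_self[of y] by linarith
        then show ?thesis using that by (simp add: exp_minus inverse_eq_divide frac_le)
      qed
      from this[of "exp (- a) * real (2 ^ i)"] show ?thesis by simp
    qed
    moreover have "prob (V i \<union> D i) \<le> prob (V i) + prob (D i)"
      using V_meas D_meas by (rule measure_Un_le)
    ultimately have "prob (V i \<union> D i) \<le> C * (T / 2 ^ i) / (exp (- (2 * a)))\<^sup>2 + 1 / (exp (- a) * 2 ^ i)"
      by linarith
    also have "\<dots> = K * (1 / 2) ^ i" by (simp add: K_def power_one_over field_simps)
    finally show "norm (prob (V i \<union> D i)) \<le> K * (1 / 2) ^ i" by simp
  qed
  then have "summable (\<lambda>i. prob (V i \<union> D i))"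
    by (rule summable_comparison_test_ev) (intro summable_mult summable_geometric, simp)
  then have "AE \<omega> in M. eventually (\<lambda>i. \<omega> \<in> space M - (V i \<union> D i)) sequentially"
    using V_meas D_meas by (intro borel_cantelli_AE1) (auto simp: emeasure_eq_measure)
  then show ?thesis
  proof eventually_elim
    fix \<omega> assume "eventually (\<lambda>i. \<omega> \<in> space M - (V i \<union> D i)) sequentially"
    then show "eventually (\<lambda>i. potential (real k powr (\<gamma> - 1)) k (2 ^ Suc i) \<omega>
      \<le> 3 / 2 * potential (real k powr (\<gamma> - 1)) k (2 ^ i) \<omega> + 12 * 2 ^ i) sequentially"
      by eventually_elim (auto simp: V_def D_def \<theta>_def)
  qed
qed

text \<open>
  The recursion along powers of two bounds the potential per vertex by 25 in the end. The number of
  vertices of degree at least \<open>k\<close> is monotone in \<open>n\<close>, so between two powers of two it can be compared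
  with the later one; this costs the factor from 25 to 50.
\<close>

lemma eventually_num_degree_ge_le:
  assumes \<omega>: "\<omega> \<in> space M"
    and ev: "eventually (\<lambda>i. potential \<theta> k (2 ^ Suc i) \<omega>
      \<le> 3 / 2 * potential \<theta> k (2 ^ i) \<omega> + 12 * 2 ^ i) sequentially"
  shows "eventually (\<lambda>n. real (num_degree_ge n (E n \<omega>) k) / real n \<le> 50 * exp (- (\<theta> * real k))) sequentially"
proof -
  have "eventually (\<lambda>i. potential \<theta> k (2 ^ i) \<omega> / 2 ^ i \<le> 25) sequentially"
    by (rule contraction_eventually_le, rule eventually_mono[OF ev]) (simp add: field_simps)
  then obtain I where I: "\<And>i. I \<le> i \<Longrightarrow> potential \<theta> k (2 ^ i) \<omega> \<le> 25 * 2 ^ i"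
    by (auto simp: eventually_sequentially field_simps)
  show ?thesis unfolding eventually_sequentially
  proof (intro exI allI impI)
    fix n :: nat assume n: "2 ^ I \<le> n"
    have n1: "1 \<le> n" using n by (metis one_le_numeral one_le_power order_trans)
    obtain i where i: "2 ^ i \<le> n" "n < 2 ^ Suc i"
      using ex_power_ivl1[of 2 n] n1 by auto
    have "I \<le> Suc i"
      using n i(2) by (metis le_less_trans less_imp_le one_less_numeral_iff power_strict_increasing_iff semiring_norm(76))
    then have "potential \<theta> k (2 ^ Suc i) \<omega> \<le> 25 * 2 ^ Suc i" by (rule I)
    also have "\<dots> \<le> 50 * real n"
    proof -
      have "real (2 ^ i) \<le> real n" using i(1) by (simp only: of_nat_le_iff)
      then show ?thesis by simp
    qed
    finally have pot: "potential \<theta> k (2 ^ Suc i) \<omega> \<le> 50 * real n" .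
    have "num_degree_ge n (E n \<omega>) k \<le> num_degree_ge (2 ^ Suc i) (E (2 ^ Suc i) \<omega>) k"
      using n1 i \<omega> by (intro num_degree_ge_mono) auto
    then have "real (num_degree_ge n (E n \<omega>) k) * exp (\<theta> * real k)
      \<le> real (num_degree_ge (2 ^ Suc i) (E (2 ^ Suc i) \<omega>) k) * exp (\<theta> * real k)"
      by (intro mult_right_mono) auto
    also have "\<dots> \<le> potential \<theta> k (2 ^ Suc i) \<omega>" by (rule num_degree_ge_le_potential)
    also note pot
    finally show "real (num_degree_ge n (E n \<omega>) k) / real n \<le> 50 * exp (- (\<theta> * real k))"
      using n1 by (simp add: exp_minus field_simps)
  qed
qed

lemma num_degree_ge_le: "num_degree_ge n A k \<le> Suc n"
proof -
  have "num_degree_ge n A k \<le> card {0..n}" unfolding num_degree_ge_def by (intro card_mono) auto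
  then show ?thesis by simp
qed

text \<open>
  Since the exponent of \<open>k\<close> in the logarithmic growth rate of the potential is negative, that rate is
  small for all \<open>k\<close> beyond some \<open>k0\<close>. The finitely many smaller \<open>k\<close> are absorbed into the constant,
  as the proportion of vertices is at most 2 in any case.
\<close>

lemma AE_eventually_num_degree_ge_le:
  fixes \<gamma> :: real
  assumes \<gamma>: "0 < \<gamma>" "\<gamma> < (s - real CARD('d)) / (2 * s - real CARD('d))"
  obtains B where "0 \<le> B" "\<And>k. 1 \<le> k \<Longrightarrow> AE \<omega> in M. eventually
    (\<lambda>n. real (num_degree_ge n (E n \<omega>) k) / real n \<le> B * exp (- (real k powr \<gamma>))) sequentially"
proof -
  obtain c' where c': "0 \<le> c'" and kernel: "\<And>A y. 0 < A \<Longrightarrow>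
      (\<integral>x. min 1 (A * dist y x powr (- s)) \<partial>location_law) \<le> c' * A powr (real CARD('d) / s)"
    using integral_truncated_kernel_le by blast
  obtain c C R where c: "0 < c" "0 \<le> C" "0 < R" and void: "\<And>n r. 0 < r \<Longrightarrow> r \<le> R \<Longrightarrow>
      prob {\<omega> \<in> space M. 2 * exp (- (c * (real n * r ^ CARD('d)))) \<le> void_mass n r \<omega>}
        \<le> C * r ^ CARD('d) / (exp (- (c * (real n * r ^ CARD('d)))))\<^sup>2"
    using prob_void_mass_large by blast
  let ?e = "2 * \<gamma> - 1 + (1 - \<gamma>) * (real CARD('d) / s)"
  have neg: "?e < 0" using s_gt_dim \<gamma> by (intro log_growth_exponent_neg) simp_all
  have \<gamma>1: "\<gamma> \<le> 1"
  proof -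
    have "0 < 2 * s - real CARD('d)" using s_gt_dim s_pos by simp
    then have "(s - real CARD('d)) / (2 * s - real CARD('d)) \<le> 1" using s_pos by (simp add: divide_le_eq_1)
    then show ?thesis using \<gamma> by simp
  qed
  have "(\<lambda>k. 4 * c' / c * real k powr ?e) \<longlonglongrightarrow> 4 * c' / c * 0"
    using neg by (intro tendsto_intros tendsto_neg_powr filterlim_real_sequentially)
  then have "eventually (\<lambda>k. 4 * c' / c * real k powr ?e < 1 / 8) sequentially"
    by (rule order_tendstoD) simp
  then obtain k0 where k0: "\<And>k. k0 \<le> k \<Longrightarrow> 4 * c' / c * real k powr ?e < 1 / 8"
    by (auto simp: eventually_sequentially)
  (* The first summand serves k \<ge> k0; the second one makes the bound exceed 2 for k < k0. *)
  define B where "B = 50 + 2 * exp (real k0 powr \<gamma>)"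
  show ?thesis
  proof (rule that)
    show "0 \<le> B" by (simp add: B_def add_nonneg_nonneg)
    fix k :: nat assume k: "1 \<le> k"
    show "AE \<omega> in M. eventually
      (\<lambda>n. real (num_degree_ge n (E n \<omega>) k) / real n \<le> B * exp (- (real k powr \<gamma>))) sequentially"
    proof (cases "k0 \<le> k")
      case True
      let ?\<theta> = "real k powr (\<gamma> - 1)"
      have "50 * exp (- (?\<theta> * real k)) \<le> B * exp (- (real k powr \<gamma>))"
        using k by (simp add: B_def powr_diff)
      moreover have "AE \<omega> in M. eventually (\<lambda>i. potential ?\<theta> k (2 ^ Suc i) \<omega>
        \<le> 3 / 2 * potential ?\<theta> k (2 ^ i) \<omega> + 12 * 2 ^ i) sequentially"
        by (rule AE_potential_doubling[OF kernel c' void c k \<gamma>1 less_imp_le[OF k0[OF True]]])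
      then have "AE \<omega> in M. eventually (\<lambda>n. real (num_degree_ge n (E n \<omega>) k) / real n
        \<le> 50 * exp (- (?\<theta> * real k))) sequentially"
        using AE_space by eventually_elim (rule eventually_num_degree_ge_le)
      ultimately show ?thesis
        by (elim eventually_mono) (auto elim: eventually_mono)
    next
      case False
      have "real (num_degree_ge n (E n \<omega>) k) / real n \<le> B * exp (- (real k powr \<gamma>))" if "1 \<le> n" for n \<omega>
      proof -
        have "real (num_degree_ge n (E n \<omega>) k) \<le> 2 * real n"
          using num_degree_ge_le[of n "E n \<omega>" k] that by linarith
        then have "real (num_degree_ge n (E n \<omega>) k) / real n \<le> 2"
          using that by (simp add: divide_le_eq)
        also have "2 \<le> 2 * exp (real k0 powr \<gamma> - real k powr \<gamma>)"
          using False \<gamma> by (auto intro!: powr_mono2)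
        also have "\<dots> \<le> B * exp (- (real k powr \<gamma>))"
          by (simp add: B_def exp_diff exp_minus field_simps)
        finally show ?thesis .
      qed
      then show ?thesis by (intro AE_I2) (auto simp: eventually_sequentially)
    qed
  qed
qed

text \<open>
  The mean inherits the bound from the almost sure one because the proportions lie in \<open>[0, 2]\<close>.
\<close>

lemma degree_tail:
  fixes \<gamma> :: real
  assumes "0 < \<gamma>" "\<gamma> < (s - real CARD('d)) / (2 * s - real CARD('d))"
  shows "\<exists>C::real. \<forall>k::nat. 1 \<le> k \<longrightarrow>
           (AE \<omega> in M.
              limsup (\<lambda>n. ereal (real (num_degree_ge n (E n \<omega>) k) / real n))
                \<le> ereal (C * exp (- (real k powr \<gamma>)))) \<and>
           limsup (\<lambda>n. ereal ((\<integral>\<omega>. real (num_degree_ge n (E n \<omega>) k) \<partial>M) / real n))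
             \<le> ereal (C * exp (- (real k powr \<gamma>)))"
proof -
  obtain B where B: "0 \<le> B" and ev: "\<And>k. 1 \<le> k \<Longrightarrow> AE \<omega> in M. eventually
    (\<lambda>n. real (num_degree_ge n (E n \<omega>) k) / real n \<le> B * exp (- (real k powr \<gamma>))) sequentially"
    using AE_eventually_num_degree_ge_le[OF assms] by blast
  show ?thesis
  proof (intro exI allI impI conjI)
    fix k :: nat assume k: "1 \<le> k"
    show "AE \<omega> in M. limsup (\<lambda>n. ereal (real (num_degree_ge n (E n \<omega>) k) / real n))
        \<le> ereal (B * exp (- (real k powr \<gamma>)))"
      using ev[OF k] by eventually_elim (intro Limsup_bounded, simp)
    define Y where "Y n \<omega> = real (num_degree_ge n (E n \<omega>) k) / real n" for n \<omega>
    have "limsup (\<lambda>n. ereal (expectation (Y n))) \<le> ereal (B * exp (- (real k powr \<gamma>)))"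
    proof (rule limsup_expectation_le[where D = 2])
      show "Y n \<in> borel_measurable M" for n
      proof (cases "1 \<le> n")
        case True
        then show ?thesis unfolding Y_def
          by (intro borel_measurable_divide measurable_compose[OF E_measurable]) auto
      next
        case False
        then have "n = 0" by simp
        then show ?thesis by (simp add: Y_def[abs_def])
      qed
      show "0 \<le> Y n \<omega>" for n \<omega> by (simp add: Y_def)
      show "Y n \<omega> \<le> 2" for n \<omega>
        using num_degree_ge_le[of n "E n \<omega>" k] by (cases n) (auto simp: Y_def divide_le_eq)
      show "AE \<omega> in M. eventually (\<lambda>n. Y n \<omega> \<le> B * exp (- (real k powr \<gamma>))) sequentially"
        using ev[OF k] by (simp add: Y_def)
    qed (use B in simp)
    moreover have "expectation (Y n) = (\<integral>\<omega>. real (num_degree_ge n (E n \<omega>) k) \<partial>M) / real n" for n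
      unfolding Y_def by (rule integral_divide_zero)
    ultimately show "limsup (\<lambda>n. ereal ((\<integral>\<omega>. real (num_degree_ge n (E n \<omega>) k) \<partial>M) / real n))
        \<le> ereal (B * exp (- (real k powr \<gamma>)))"
      by simp
  qed
qed

end

theorem theorem2p7:
  fixes M :: "'w measure"
    and S :: "(real ^ 'd::finite) set"
    and f :: "real ^ 'd \<Rightarrow> real"
    and X :: "nat \<Rightarrow> 'w \<Rightarrow> real ^ 'd"
    and v :: "nat \<Rightarrow> 'w \<Rightarrow> nat"
    and E :: "nat \<Rightarrow> 'w \<Rightarrow> (nat \<times> nat) set"
    and s \<gamma> :: real
  assumes "gpa_graph M S f (\<lambda>r. r powr (- s)) X v E"
    and "0 < (INF x\<in>S. ereal (f x))"
    and "(SUP x\<in>S. ereal (f x)) < \<infinity>"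
    and "s > real CARD('d)"
    and "\<gamma> \<in> {0 <..< (s - real CARD('d)) / (2 * s - real CARD('d))}"
  shows "\<exists>C::real. \<forall>k::nat. 1 \<le> k \<longrightarrow>
           (AE \<omega> in M.
              limsup (\<lambda>n. ereal (real (num_degree_ge n (E n \<omega>) k) / real n))
                \<le> ereal (C * exp (- (real k powr \<gamma>)))) \<and>
           limsup (\<lambda>n. ereal ((\<integral>\<omega>. real (num_degree_ge n (E n \<omega>) k) \<partial>M) / real n))
             \<le> ereal (C * exp (- (real k powr \<gamma>)))"
proof -
  interpret gpa_graph M S f "\<lambda>r. r powr (- s)" X v E by (rule assms(1))
  obtain l where l: "0 < l" "ereal l < (INF x\<in>S. ereal (f x))"
    using ereal_dense2[OF assms(2)] by (auto simp: zero_ereal_def)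
  obtain b where b: "(SUP x\<in>S. ereal (f x)) < ereal b"
    using ereal_dense2[OF assms(3)] by auto
  have fb: "f x \<le> max 0 b" for x
  proof (cases "x \<in> S")
    case True
    then have "ereal (f x) \<le> (SUP x\<in>S. ereal (f x))" by (rule SUP_upper)
    then show ?thesis using b by (metis le_less_trans less_ereal.simps(1) less_imp_le max.coboundedI2)
  qed (simp add: density_support)
  have fl: "l \<le> f x" if "x \<in> S" for x
  proof -
    have "(INF x\<in>S. ereal (f x)) \<le> ereal (f x)" using that by (rule INF_lower)
    then show ?thesis using l(2) by (metis less_le_trans less_ereal.simps(1) less_imp_le)
  qed
  interpret power_law_gpa M S f X v E s l "max 0 b"
    using l(1) fl fb assms(4) by unfold_locales
  show ?thesis using assms(5) by (intro degree_tail) auto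
qed

end
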